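(* There exists $\epsilon>0$ such that for every post-critically finite unimodal map $f$ and every Galois conjugate $z\in\mathbb{C}$ of $e^{h_{\mathrm{top}}(f)}$ with $z\notin\mathbb{R}$, one has $|z|<2-\epsilon$. Here $h_{\mathrm{top}}(f)$ denotes the topological entropy of $f$.
   Context: A unimodal map is a continuous map $f:[0,1]\to[0,1]$ for which there is a point $c\in(0,1)$ (the critical, or turning, point) such that $f$ is strictly monotone on $[0,c]$ and on $[c,1]$, with opposite directions of monotonicity on the two intervals. It is post-critically finite (PCF) if the forward orbit $\{f^j(c): j\geq0\}$ of the critical point is a finite set. The topological entropy of a piecewise monotonic interval map $f$ is $h_{\mathrm{top}}(f)=\lim_{n\to\infty}\frac1n\log\#\{\text{branches (maximal intervals) of monotonicity of } f^n\}$. For a PCF unimodal map $f$, the number $e^{h_{\mathrm{top}}(f)}$ is algebraic, and its Galois conjugates are the other complex roots of its minimal polynomial over $\mathbb{Q}$. *)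

theory Defs
  imports "HOL-Analysis.Analysis" "HOL-Computational_Algebra.Computational_Algebra"
begin

(* Interval maps are total functions on the reals of which only the values on [0,1] matter. *)

definition turning_point :: "(real \<Rightarrow> real) \<Rightarrow> real \<Rightarrow> bool" where
  "turning_point f c \<longleftrightarrow> 0 < c \<and> c < 1 \<and>
     (strict_mono_on {0..c} f \<and> strict_antimono_on {c..1} f \<or>
      strict_antimono_on {0..c} f \<and> strict_mono_on {c..1} f)"

definition unimodal :: "(real \<Rightarrow> real) \<Rightarrow> bool" where
  "unimodal f \<longleftrightarrow> continuous_on {0..1} f \<and> f ` {0..1} \<subseteq> {0..1} \<and> (\<exists>c. turning_point f c)"

(* A unimodal map has exactly one turning point, so the choice of c is immaterial. *)
definition post_critically_finite :: "(real \<Rightarrow> real) \<Rightarrow> bool" where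
  "post_critically_finite f \<longleftrightarrow> (\<exists>c. turning_point f c \<and> finite (range (\<lambda>j. (f ^^ j) c)))"

definition monotone_interval :: "(real \<Rightarrow> real) \<Rightarrow> real set \<Rightarrow> bool" where
  "monotone_interval g J \<longleftrightarrow> is_interval J \<and> J \<subseteq> {0..1} \<and> (mono_on J g \<or> antimono_on J g)"

(* Monotonicity is weak, as usual for piecewise monotone maps. An iterate of a unimodal map is
   constant on no nondegenerate interval, so for it the strict version gives the same branches. *)
definition branches :: "(real \<Rightarrow> real) \<Rightarrow> real set set" where
  "branches g = {J. monotone_interval g J \<and> (\<forall>K. monotone_interval g K \<and> J \<subseteq> K \<longrightarrow> K = J)}"

definition h_top :: "(real \<Rightarrow> real) \<Rightarrow> real" where
  "h_top f = lim (\<lambda>n. ln (real (card (branches (f ^^ n)))) / real n)"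

definition minimal_polynomial :: "rat poly \<Rightarrow> complex \<Rightarrow> bool" where
  "minimal_polynomial p x \<longleftrightarrow> lead_coeff p = 1 \<and> poly (map_poly of_rat p) x = 0 \<and>
     (\<forall>q. q \<noteq> 0 \<and> poly (map_poly of_rat q) x = 0 \<longrightarrow> degree p \<le> degree q)"

definition galois_conjugate :: "complex \<Rightarrow> complex \<Rightarrow> bool" where
  "galois_conjugate z x \<longleftrightarrow> z \<noteq> x \<and>
     (\<exists>p. minimal_polynomial p x \<and> poly (map_poly of_rat p) z = 0)"

end

(* Let l = exp (h_top f). The turning points of the iterates of f are the preimages of the turning
   point c in the open interval; let g j count those that first reach c at time j, and let a j be the
   slope sign of the j-th iterate of f at the point f c, so that a 0 = 1. The slope sign of the
   (k+1)-st iterate is a step function that jumps by +-2 a (k - j), with a common sign, at the points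
   counted by g j; telescoping gives |sum_{j<=k} g j * a (k - j)| <= 1 (a form of the Milnor-Thurston
   identity). Since the lap numbers 1 + sum_{j<n} g j grow at least like l^n, the generating function
   of g blows up at 1/l, which forces sum_j a j * l^(-j) = 0 when l > 1.

   If f is post-critically finite, a is eventually periodic, so this equation amounts to a polynomial
   equation over the rationals and passes to every conjugate z with |z| > 1. Finally, for t = 1/z close
   to the circle |t| = 1/2, the equation sum_j a j * t^j = 0 forces the terms with j > 0 to be almost
   aligned, so t is close to 1/2 or -1/2 and a 1, a 2, a 3 are determined; if t were not real, the
   imaginary part of the sum divided by Im t could then not vanish. *)

theory Submission
  imports Defs
begin

section \<open>Zeros of power series with coefficients 1 and -1\<close>

text \<open>The factor \<open>Im t\<close> on the right allows the imaginary part of a power series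
  to be divided by \<open>Im t\<close>, with bounds that do not degenerate near the real
  axis.\<close>

lemma abs_Im_power_le: "\<bar>Im (t ^ n)\<bar> \<le> real n * cmod t ^ (n - 1) * \<bar>Im t\<bar>"
proof (induction n)
  case (Suc n)
  have "\<bar>Im (t ^ Suc n)\<bar> \<le> \<bar>Re (t ^ n)\<bar> * \<bar>Im t\<bar> + \<bar>Im (t ^ n)\<bar> * \<bar>Re t\<bar>"
    by (simp add: power_Suc2 abs_mult [symmetric] del: power_Suc)
  also have "\<dots> \<le> cmod t ^ n * \<bar>Im t\<bar> + (real n * cmod t ^ (n - 1) * \<bar>Im t\<bar>) * cmod t"
    using Suc abs_Re_le_cmod [of "t ^ n"] abs_Re_le_cmod [of t]
    by (intro add_mono mult_mono) (auto simp: norm_power)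
  also have "\<dots> = real (Suc n) * cmod t ^ n * \<bar>Im t\<bar>"
    by (cases n) (auto simp: algebra_simps)
  finally show ?case by simp
qed simp

text \<open>The real part of a vanishing series would force \<open>t\<close> to be close to
  \<open>1/2\<close> and \<open>a 1\<close>, \<open>a 2\<close>, \<open>a 3\<close> to be negative.
  The imaginary parts of these three terms then add up to more than the remaining terms can
  cancel.\<close>

lemma sign_series_nonzero_right_half:
  fixes a :: "nat \<Rightarrow> real" and t :: complex
  assumes a0: "a 0 = 1" and a: "\<And>j. a j = 1 \<or> a j = -1"
    and t: "cmod t \<le> 51/100" "t \<notin> \<real>" "Re t \<ge> 0"
  shows "\<not> (\<lambda>j. of_real (a j) * t ^ j) sums 0"
proof
  assume sum0: "(\<lambda>j. of_real (a j) * t ^ j) sums 0"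
  define r x y where "r = cmod t" and "x = Re t" and "y = Im t"
  have y0: "y \<noteq> 0" using t(2) by (simp add: y_def complex_is_Real_iff)
  have r: "0 \<le> r" "r \<le> 51/100" and x0: "x \<ge> 0" and r2: "r\<^sup>2 = x\<^sup>2 + y\<^sup>2"
    using t by (auto simp: r_def x_def y_def cmod_def)
  have absa: "\<bar>a j\<bar> = 1" for j using a [of j] by auto
  \<comment> \<open>Adding the geometric series in \<open>r\<close> makes every term nonnegative, so
    any finite selection of terms is at most \<open>1 / (1 - r)\<close>.\<close>
  have re: "(\<lambda>j. r ^ j + a j * Re (t ^ j)) sums (1 / (1 - r) + 0)"
    using sums_Re [OF sum0] geometric_sums [of r] r by (intro sums_add) auto
  have re_nonneg: "0 \<le> r ^ j + a j * Re (t ^ j)" for j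
  proof -
    have "\<bar>a j * Re (t ^ j)\<bar> \<le> r ^ j"
      using abs_Re_le_cmod [of "t ^ j"] by (simp add: abs_mult absa r_def norm_power)
    then show ?thesis by linarith
  qed
  \<comment> \<open>The term at index 0 equals 2 and \<open>1 / (1 - r)\<close> is at most 100/49,
    which leaves at most 2/49 for any other term.\<close>
  have key: "2 + (r ^ j + a j * Re (t ^ j)) \<le> 100/49" if "j > 0" for j
  proof -
    have "(\<Sum>i\<in>{0,j}. r ^ i + a i * Re (t ^ i)) \<le> 1 / (1 - r) + 0"
      using sums_unique [OF re] sum_le_suminf [OF sums_summable [OF re], of "{0,j}"] re_nonneg by simp
    moreover have "1 / (1 - r) \<le> 100/49" using r by (simp add: field_simps)
    ultimately show ?thesis using that a0 by simp
  qed
  have re2: "Re (t ^ 2) = 2 * x\<^sup>2 - r\<^sup>2" and re3: "Re (t ^ 3) = 4 * x ^ 3 - 3 * x * r\<^sup>2"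
    unfolding r2 by (simp_all add: power2_eq_square power3_eq_cube x_def y_def algebra_simps)
  have im2: "Im (t ^ 2) = y * (2 * x)" and im3: "Im (t ^ 3) = y * (3 * x\<^sup>2 - y\<^sup>2)"
    by (simp_all add: power2_eq_square power3_eq_cube x_def y_def algebra_simps)
  have half: "r \<ge> 1/2"
  proof -
    have "2 \<le> 1 / (1 - r)"
      using sums_unique [OF re] sum_le_suminf [OF sums_summable [OF re], of "{0}"] re_nonneg a0 by simp
    then show ?thesis using r by (simp add: field_simps)
  qed
  \<comment> \<open>A positive sign would give a term above 2/49: at least \<open>r\<close> here,
    \<open>2 * x\<^sup>2\<close> at index 2, and \<open>r ^ 3\<close> plus a nonnegative quantity at
    index 3.\<close>
  have a1: "a 1 = -1" using a [of 1] key [of 1] half x0 by (auto simp: x_def)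
  then have xr: "x \<ge> r - 2/49" using key [of 1] by (simp add: x_def)
  have x45: "x \<ge> 45/100" using xr half by linarith
  have xsq: "x\<^sup>2 \<ge> (45/100)\<^sup>2" and rsq: "r\<^sup>2 \<le> (51/100)\<^sup>2" and rsq': "r\<^sup>2 \<ge> (1/2)\<^sup>2"
    using x45 r half by (auto intro!: power_mono)
  have "2 + (r\<^sup>2 + a 2 * (2 * x\<^sup>2 - r\<^sup>2)) \<le> 100/49" using key [of 2] unfolding re2 by simp
  then have a2: "a 2 = -1" using a [of 2] xsq by (auto simp: power2_eq_square)
  have a3: "a 3 = -1"
  proof (rule ccontr)
    assume "a 3 \<noteq> -1"
    then have "2 + (r ^ 3 + (4 * x ^ 3 - 3 * x * r\<^sup>2)) \<le> 100/49"
      using a [of 3] key [of 3] unfolding re3 by auto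
    moreover have "r ^ 3 \<ge> (1/2) ^ 3" using half by (intro power_mono) auto
    moreover have "x * (4 * x\<^sup>2 - 3 * r\<^sup>2) \<ge> x * (4 * (45/100)\<^sup>2 - 3 * (51/100)\<^sup>2)"
      using x0 xsq rsq by (intro mult_left_mono) linarith+
    ultimately show False using x45
      by (simp add: power2_eq_square power3_eq_cube algebra_simps)
  qed
  \<comment> \<open>The same device for imaginary parts: the majorant is the derivative of the
    geometric series times \<open>\<bar>y\<bar>\<close>, and \<open>sgn y\<close> covers both
    half-planes.\<close>
  have im: "(\<lambda>j. (real j * r ^ (j - 1)) * \<bar>y\<bar> - sgn y * (a j * Im (t ^ j))) sums (1 / (1 - r)\<^sup>2 * \<bar>y\<bar> - sgn y * 0)"
  proof (intro sums_diff sums_mult sums_mult2)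
    have "(\<lambda>j. real j * r ^ (j - 1)) sums (0 + 1 / (1 - r)\<^sup>2)"
      using geometric_deriv_sums [of r] r sums_Suc [of "\<lambda>j. real j * r ^ (j - 1)" "1 / (1 - r)\<^sup>2"]
      by (simp add: sums_Suc_iff)
    then show "(\<lambda>j. real j * r ^ (j - 1)) sums (1 / (1 - r)\<^sup>2)" by simp
    show "(\<lambda>j. a j * Im (t ^ j)) sums 0" using sums_Im [OF sum0] by simp
  qed
  have im_nonneg: "0 \<le> (real j * r ^ (j - 1)) * \<bar>y\<bar> - sgn y * (a j * Im (t ^ j))" for j
  proof -
    have "\<bar>sgn y * (a j * Im (t ^ j))\<bar> \<le> (real j * r ^ (j - 1)) * \<bar>y\<bar>"
      using abs_Im_power_le [of t j] y0 by (simp add: abs_mult absa r_def y_def)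
    then show ?thesis by linarith
  qed
  have "(\<Sum>j\<in>{1,2,3}. (real j * r ^ (j - 1)) * \<bar>y\<bar> - sgn y * (a j * Im (t ^ j))) \<le> 1 / (1 - r)\<^sup>2 * \<bar>y\<bar> - sgn y * 0"
    using sums_unique [OF im] sum_le_suminf [OF sums_summable [OF im], of "{1,2,3}"] im_nonneg by simp
  also have "(\<Sum>j\<in>{1,2,3}. (real j * r ^ (j - 1)) * \<bar>y\<bar> - sgn y * (a j * Im (t ^ j)))
      = \<bar>y\<bar> * (2 + 2 * r + 2 * x + 3 * r\<^sup>2 + 3 * x\<^sup>2 - y\<^sup>2)"
    using a1 a2 a3 by (simp add: im2 im3 y_def [symmetric] algebra_simps abs_sgn [of y])
  finally have "(2 + 2 * r + 2 * x + 3 * r\<^sup>2 + 3 * x\<^sup>2 - y\<^sup>2) * \<bar>y\<bar> \<le> 1 / (1 - r)\<^sup>2 * \<bar>y\<bar>"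
    by (simp only: mult.commute [of "\<bar>y\<bar>"] mult_zero_right diff_0_right)
  then have "2 + 2 * r + 2 * x + 3 * r\<^sup>2 + 3 * x\<^sup>2 - y\<^sup>2 \<le> 1 / (1 - r)\<^sup>2"
    by (rule mult_right_le_imp_le) (use y0 in simp)
  moreover have "1 / (1 - r)\<^sup>2 \<le> 1 / (49/100)\<^sup>2"
    using r by (intro divide_left_mono power_mono mult_pos_pos) auto
  moreover have "y\<^sup>2 = r\<^sup>2 - x\<^sup>2" using r2 by simp
  \<comment> \<open>Once \<open>y\<^sup>2\<close> is eliminated, the left-hand side exceeds 5, while
    the right-hand side is below 4.2.\<close>
  ultimately show False using half x45 xsq rsq rsq' by (simp add: power2_eq_square)
qed

text \<open>The case of negative real part reduces to the other one because \<open>(-1)\<^sup>j\<close> is absorbed into the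
  coefficients.\<close>

lemma sign_series_nonzero:
  fixes a :: "nat \<Rightarrow> real" and t :: complex
  assumes "a 0 = 1" and a: "\<And>j. a j = 1 \<or> a j = -1"
    and "cmod t \<le> 51/100" "t \<notin> \<real>"
  shows "\<not> (\<lambda>j. of_real (a j) * t ^ j) sums 0"
proof (cases "Re t \<ge> 0")
  case True
  then show ?thesis using sign_series_nonzero_right_half assms by blast
next
  case False
  have "\<not> (\<lambda>j. of_real (a j * (-1) ^ j) * (- t) ^ j) sums 0"
  proof (rule sign_series_nonzero_right_half)
    show "a j * (-1) ^ j = 1 \<or> a j * (-1) ^ j = -1" for j using a [of j] by (cases "even j") auto
    show "- t \<notin> \<real>" using assms(4) Reals_minus [of "- t"] by auto
  qed (use assms False in auto)
  moreover have "of_real (a j * (-1) ^ j) * (- t) ^ j = of_real (a j) * t ^ j" for j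
    by (cases "even j") auto
  ultimately show ?thesis by (simp only: not_False_eq_True)
qed

section \<open>Subadditive sequences and convolutions\<close>

text \<open>Fekete's lemma. The limit is the infimum of the quotients, so it also bounds every
  single term from below.\<close>

lemma fekete:
  fixes a :: "nat \<Rightarrow> real"
  assumes sub: "\<And>m n. a (m + n) \<le> a m + a n" and nonneg: "\<And>n. 0 \<le> a n"
  obtains L where "(\<lambda>n. a n / real n) \<longlonglongrightarrow> L" "\<And>n. real n * L \<le> a n"
proof
  define L where "L = (INF n\<in>{0<..}. a n / real n)"
  have bdd: "bdd_below ((\<lambda>n. a n / real n) ` {0<..})"
    using nonneg by (intro bdd_belowI [of _ 0]) auto
  have le: "L \<le> a n / real n" if "n > 0" for n
    unfolding L_def using that bdd by (intro cINF_lower) auto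
  show "real n * L \<le> a n" for n
    using le [of n] nonneg [of 0] by (cases "n = 0") (auto simp: field_simps)
  have mult: "a (q * m + s) \<le> real q * a m + a s" for q m s
  proof (induction q)
    case (Suc q)
    have "a (Suc q * m + s) \<le> a m + a (q * m + s)" using sub [of m "q * m + s"] by (simp add: add.assoc)
    with Suc show ?case by (simp add: algebra_simps)
  qed simp
  show "(\<lambda>n. a n / real n) \<longlonglongrightarrow> L"
  proof (rule LIMSEQ_I)
    fix e :: real assume e: "e > 0"
    have "\<exists>n\<in>{0<..}. a n / real n < L + e / 2"
      using cINF_less_iff [of "{0<..}" "\<lambda>n. a n / real n" "L + e / 2"] bdd e unfolding L_def by auto
    then obtain m where m: "m > 0" "a m / real m < L + e / 2" by auto
    \<comment> \<open>Dividing \<open>n\<close> by the fixed \<open>m\<close> leaves a remainder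
      below \<open>m\<close>, whose contribution is at most \<open>C\<close> for every
      \<open>n\<close>.\<close>
    define C where "C = (\<Sum>s<m. a s)"
    have C: "a s \<le> C" if "s < m" for s
      unfolding C_def using that nonneg by (intro member_le_sum) auto
    have upper: "a n / real n \<le> a m / real m + C / real n" if n: "n > 0" for n
    proof -
      have "a n \<le> real (n div m) * a m + C"
        using mult [of "n div m" m "n mod m"] C [of "n mod m"] m by simp
      also have "real (n div m) \<le> real n / real m" by (rule of_nat_div_le_of_nat)
      then have "real (n div m) * a m \<le> real n / real m * a m"
        using nonneg by (intro mult_right_mono) auto
      finally show ?thesis using n by (simp add: field_simps)
    qed
    have "(\<lambda>n. C / real n) \<longlonglongrightarrow> 0" by (rule lim_const_over_n)
    then have "\<forall>\<^sub>F n in sequentially. C / real n < e / 2" using e by (intro order_tendstoD) auto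
    then obtain N where N: "\<And>n. n \<ge> N \<Longrightarrow> C / real n < e / 2"
      by (auto simp: eventually_sequentially)
    have "norm (a n / real n - L) < e" if "n \<ge> max N 1" for n
    proof -
      have "n > 0" "n \<ge> N" using that by auto
      then have "a n / real n < L + e" "L \<le> a n / real n"
        using upper [of n] N [of n] le [of n] m by linarith+
      then show ?thesis by simp
    qed
    then show "\<exists>N. \<forall>n\<ge>N. norm (a n / real n - L) < e" by blast
  qed
qed

text \<open>With \<open>D\<close> and \<open>S\<close> the generating functions of \<open>a\<close> and \<open>g\<close>, the hypotheses give
  \<open>\<bar>S t * D t\<bar> \<le> 1 / (1 - t)\<close>, while \<open>S t\<close> blows up as \<open>t\<close> tends to \<open>1 / \<lambda>\<close> from the left.\<close>

lemma convolution_bounded_imp_root: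
  fixes a g :: "nat \<Rightarrow> real" and l :: real
  assumes l: "l > 1"
    and a: "\<And>j. \<bar>a j\<bar> \<le> 1" and g: "\<And>j. 0 \<le> g j"
    and conv: "\<And>k. \<bar>\<Sum>j\<le>k. g j * a (k - j)\<bar> \<le> 1"
    and lower: "\<And>n. l ^ n \<le> 1 + (\<Sum>j<n. g j)"
    and growth: "(\<lambda>n. ln (1 + (\<Sum>j<n. g j)) / real n) \<longlonglongrightarrow> ln l"
  shows "(\<lambda>j. a j * (1 / l) ^ j) sums 0"
proof -
  define N where "N n = 1 + (\<Sum>j<n. g j)" for n
  define r where "r = 1 / l"
  define D where "D t = (\<Sum>j. a j * t ^ j)" for t
  have N1: "N n \<ge> 1" for n unfolding N_def using g by (simp add: sum_nonneg)
  have r: "0 < r" "r < 1" using l by (auto simp: r_def)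
  have summ: "summable (\<lambda>j. \<bar>a j * t ^ j\<bar>)" if "0 < t" "t < 1" for t
  proof (rule summable_comparison_test')
    show "summable (\<lambda>j. t ^ j)" using that by (simp add: summable_geometric)
    show "norm \<bar>a j * t ^ j\<bar> \<le> t ^ j" for j
      using a [of j] that mult_right_mono [of "\<bar>a j\<bar>" 1 "t ^ j"] by (simp add: abs_mult)
  qed
  \<comment> \<open>The right-hand side vanishes at \<open>t = 1 / l\<close>, so by continuity
    \<open>D\<close> must vanish there too.\<close>
  have bound: "\<bar>D t\<bar> * (l - 1) \<le> (1 - l * t) / (1 - t)" if t: "0 < t" "t < r" for t
  proof -
    have t1: "t < 1" using t r by linarith
    have lt: "l * t < 1" using t l by (auto simp: r_def field_simps)
    have "ln l + ln t < 0" using ln_mult_pos [of l t] ln_less_zero [of "l * t"] lt l t by simp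
    \<comment> \<open>The midpoint of \<open>ln l\<close> and \<open>- ln t\<close>: large enough to
      dominate the growth of \<open>N\<close>, small enough that \<open>exp M * t\<close> stays
      below 1.\<close>
    define M where "M = (ln l - ln t) / 2"
    have M: "ln l < M" "M + ln t < 0" using \<open>ln l + ln t < 0\<close> by (simp_all add: M_def field_simps)
    have ev: "\<forall>\<^sub>F n in sequentially. N n * t ^ n \<le> (exp M * t) ^ n"
      using order_tendstoD(2) [OF growth M(1)] eventually_gt_at_top [of 0]
    proof eventually_elim
      case (elim n)
      have "ln (N n) \<le> real n * M" using elim by (simp add: N_def field_simps)
      then have "exp (ln (N n)) \<le> exp M ^ n" by (simp add: exp_of_nat_mult [symmetric])
      then have "N n \<le> exp M ^ n" using N1 [of n] by simp
      then show ?case using t by (simp add: power_mult_distrib mult_right_mono)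
    qed
    have sN: "summable (\<lambda>n. N n * t ^ n)"
    proof (rule summable_comparison_test_ev)
      have "exp M * t = exp (M + ln t)" using t by (simp add: exp_add)
      then have "exp M * t < 1" using M by simp
      then show "summable (\<lambda>n. (exp M * t) ^ n)" using t by (simp add: summable_geometric)
      show "\<forall>\<^sub>F n in sequentially. norm (N n * t ^ n) \<le> (exp M * t) ^ n"
        using ev t N1 order_trans [OF zero_le_one N1] by simp
    qed
    have sN': "summable (\<lambda>n. N (Suc n) * t ^ n)"
    proof -
      have "summable (\<lambda>n. N (Suc n) * t ^ Suc n * (1 / t))"
        using sN summable_Suc_iff [of "\<lambda>n. N n * t ^ n"] by (intro summable_mult2) simp
      then show ?thesis using t by simp
    qed
    have sg: "summable (\<lambda>n. \<bar>g n * t ^ n\<bar>)"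
    proof (rule summable_comparison_test' [OF sN'])
      fix n :: nat
      have "g n \<le> N (Suc n)" using g by (simp add: N_def sum_nonneg add_nonneg_nonneg)
      then show "norm \<bar>g n * t ^ n\<bar> \<le> N (Suc n) * t ^ n" using g [of n] t by (simp add: abs_mult mult_right_mono)
    qed
    define S where "S = (\<Sum>n. g n * t ^ n)"
    have geo: "(\<lambda>n. t ^ n) sums (1 / (1 - t))" using t t1 by (intro geometric_sums) auto
    \<comment> \<open>Multiplying by the geometric series turns the coefficients \<open>g\<close>
      into their partial sums, hence into \<open>N\<close>.\<close>
    have "(\<lambda>k. \<Sum>j\<le>k. (g j * t ^ j) * t ^ (k - j)) sums (S * (1 / (1 - t)))"
      unfolding S_def sums_unique [OF geo] using sg t t1 by (intro Cauchy_product_sums) (auto simp: summable_geometric)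
    moreover have "(\<Sum>j\<le>k. (g j * t ^ j) * t ^ (k - j)) = (\<Sum>j\<le>k. g j) * t ^ k" for k
      unfolding sum_distrib_right by (intro sum.cong) (auto simp: power_add [symmetric])
    ultimately have "(\<lambda>k. t ^ k + (\<Sum>j\<le>k. g j) * t ^ k) sums (1 / (1 - t) + S * (1 / (1 - t)))"
      using geo by (intro sums_add) simp_all
    moreover have "t ^ k + (\<Sum>j\<le>k. g j) * t ^ k = N (Suc k) * t ^ k" for k
      by (simp add: N_def lessThan_Suc_atMost algebra_simps)
    ultimately have sumN: "(\<lambda>k. N (Suc k) * t ^ k) sums (1 / (1 - t) + S * (1 / (1 - t)))" by simp
    have sum_l: "(\<lambda>k. l * (l * t) ^ k) sums (l * (1 / (1 - l * t)))"
      using t l lt by (intro sums_mult geometric_sums) auto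
    have "l * (l * t) ^ k \<le> N (Suc k) * t ^ k" for k
      using lower [of "Suc k"] t by (simp add: N_def power_mult_distrib mult.assoc [symmetric] mult_right_mono)
    then have "l * (1 / (1 - l * t)) \<le> 1 / (1 - t) + S * (1 / (1 - t))"
      using sum_l sumN by (rule sums_le)
    \<comment> \<open>The left-hand side simplifies to \<open>l - 1\<close>: this is the blow-up of
      \<open>S\<close> at \<open>1 / l\<close> in quantitative form.\<close>
    then have S_ge: "l * (1 - t) - (1 - l * t) \<le> S * (1 - l * t)"
      using t1 lt by (simp add: field_simps)
    have SD: "(\<lambda>k. \<Sum>j\<le>k. (g j * t ^ j) * (a (k - j) * t ^ (k - j))) sums (S * D t)"
      unfolding S_def D_def using sg summ [OF t(1) t1] by (intro Cauchy_product_sums) auto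
    have coef: "(\<Sum>j\<le>k. (g j * t ^ j) * (a (k - j) * t ^ (k - j))) = (\<Sum>j\<le>k. g j * a (k - j)) * t ^ k" for k
      unfolding sum_distrib_right by (intro sum.cong) (auto simp: power_add [symmetric])
    have le: "\<bar>(\<Sum>j\<le>k. g j * a (k - j)) * t ^ k\<bar> \<le> t ^ k" for k
      using conv [of k] t mult_right_mono [OF conv [of k], of "t ^ k"] by (simp add: abs_mult)
    have "\<bar>S * D t\<bar> \<le> 1 / (1 - t)"
    proof -
      have "S * D t \<le> 1 / (1 - t)"
        using sums_le [OF _ SD geo] le by (simp add: coef abs_le_iff)
      moreover have "- (S * D t) \<le> 1 / (1 - t)"
        using sums_le [OF _ sums_minus [OF SD] geo] le by (simp add: coef abs_le_iff)
      ultimately show ?thesis by simp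
    qed
    moreover have "S \<ge> 0"
      unfolding S_def using sg g t by (intro suminf_nonneg) (auto intro: summable_rabs_cancel)
    ultimately have "S * \<bar>D t\<bar> * (1 - l * t) \<le> 1 / (1 - t) * (1 - l * t)"
      using lt by (intro mult_right_mono) (auto simp: abs_mult)
    moreover have "\<bar>D t\<bar> * (l * (1 - t) - (1 - l * t)) \<le> \<bar>D t\<bar> * (S * (1 - l * t))"
      using S_ge by (intro mult_left_mono) auto
    ultimately show ?thesis by (simp add: algebra_simps)
  qed
  obtain K where K: "r < K" "K < 1" using r dense by blast
  have "isCont D r"
    unfolding D_def using summ [of K] K r by (intro isCont_powser [of _ K]) (auto intro: summable_rabs_cancel)
  then have cD: "(D \<longlongrightarrow> D r) (at_left r)"
    unfolding isCont_def by (rule filterlim_mono) (auto simp: at_within_le_at)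
  have "\<bar>D r\<bar> * (l - 1) \<le> (1 - l * r) / (1 - r)"
  proof (rule tendsto_le)
    show "((\<lambda>t. (1 - l * t) / (1 - t)) \<longlongrightarrow> (1 - l * r) / (1 - r)) (at_left r)"
      using r by (intro tendsto_intros) auto
    show "((\<lambda>t. \<bar>D t\<bar> * (l - 1)) \<longlongrightarrow> \<bar>D r\<bar> * (l - 1)) (at_left r)"
      by (intro tendsto_intros cD)
    show "\<forall>\<^sub>F t in at_left r. \<bar>D t\<bar> * (l - 1) \<le> (1 - l * t) / (1 - t)"
      using eventually_at_left_real [OF r(1)] by eventually_elim (use bound in auto)
  qed simp
  then have "\<bar>D r\<bar> * (l - 1) \<le> 0" using l by (simp add: r_def)
  then have "D r = 0" using l by (simp add: mult_le_0_iff)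
  moreover have "(\<lambda>j. a j * r ^ j) sums D r"
    unfolding D_def using summ [OF r] by (rule summable_sums [OF summable_rabs_cancel])
  ultimately show ?thesis by (simp add: r_def)
qed

section \<open>Passing to Galois conjugates\<close>

lemma map_poly_of_rat_mult:
  "map_poly of_rat (p * q) = map_poly of_rat p * (map_poly of_rat q :: 'a::field_char_0 poly)"
  by (rule poly_eqI) (simp add: coeff_map_poly coeff_mult of_rat_sum of_rat_mult)

lemma map_poly_of_rat_add:
  "map_poly of_rat (p + q) = map_poly of_rat p + (map_poly of_rat q :: 'a::field_char_0 poly)"
  by (rule poly_eqI) (simp add: coeff_map_poly of_rat_add)

lemma map_poly_of_rat_diff:
  "map_poly of_rat (p - q) = map_poly of_rat p - (map_poly of_rat q :: 'a::field_char_0 poly)"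
  by (rule poly_eqI) (simp add: coeff_map_poly of_rat_diff)

text \<open>Division by the minimal polynomial leaves a remainder that vanishes at \<open>x\<close>
  and has smaller degree, so it is zero.\<close>

lemma galois_conjugate_root:
  assumes conj: "galois_conjugate z x" and root: "poly (map_poly of_rat q) x = 0"
  shows "poly (map_poly of_rat q) z = 0"
proof -
  obtain p where p: "minimal_polynomial p x" and z: "poly (map_poly of_rat p) z = 0"
    using conj by (auto simp: galois_conjugate_def)
  have p0: "p \<noteq> 0" and px: "poly (map_poly of_rat p) x = 0" using p by (auto simp: minimal_polynomial_def)
  define d r where "d = q div p" and "r = q mod p"
  have q: "q = d * p + r" by (simp add: d_def r_def)
  have "poly (map_poly of_rat r) x = 0"
    using root px unfolding q by (simp add: map_poly_of_rat_mult map_poly_of_rat_add)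
  then have "r = 0"
    using p p0 degree_mod_less [OF p0, of q] unfolding minimal_polynomial_def r_def by force
  then show ?thesis using z unfolding q by (simp add: map_poly_of_rat_mult map_poly_of_rat_add)
qed

text \<open>The coefficients are listed from the leading one downwards.\<close>

primrec horner_poly :: "(nat \<Rightarrow> 'a::zero) \<Rightarrow> nat \<Rightarrow> 'a poly" where
  "horner_poly c 0 = [:c 0:]"
| "horner_poly c (Suc k) = pCons (c (Suc k)) (horner_poly c k)"

lemma map_poly_horner_poly:
  "map_poly of_rat (horner_poly c k) = horner_poly (\<lambda>j. of_rat (c j)) k"
  by (induction k) (simp_all add: map_poly_pCons)

lemma poly_horner_poly:
  fixes x :: "'a::field"
  assumes "x \<noteq> 0"
  shows "poly (horner_poly c k) x = x ^ k * (\<Sum>j\<le>k. c j * (1 / x) ^ j)"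
  using assms by (induction k) (simp_all add: field_simps)

text \<open>Horner values obey the recursion "multiply by \<open>x\<close>, add the next
  coefficient". Once two of them agree and the coefficients that follow are periodic, they agree
  forever.\<close>

lemma horner_poly_eventually_periodic:
  assumes per: "\<And>j. j > m \<Longrightarrow> c (j + q) = c j"
    and eq: "poly (horner_poly c (m + q)) x = poly (horner_poly c m) x"
  shows "poly (horner_poly c (m + i * q)) x = poly (horner_poly c m) x"
proof -
  have step: "poly (horner_poly c (m + q + j)) x = poly (horner_poly c (m + j)) x" for j
  proof (induction j)
    case (Suc j)
    have "c (Suc (m + j) + q) = c (Suc (m + j))" by (rule per) simp
    with Suc show ?case by (simp add: add_ac)
  qed (use eq in simp)
  show ?thesis
  proof (induction i)
    case (Suc i)
    then show ?case using step [of "i * q"] by (simp add: add_ac)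
  qed simp
qed

text \<open>A partial sum of a series with sum 0 is minus its tail. Hence the Horner value depends
  only on the later coefficients, and periodicity makes two such values equal at
  \<open>x\<close>.\<close>

lemma horner_poly_eq_tail:
  fixes x :: "'a::{real_normed_field}"
  assumes "(\<lambda>j. c j * (1 / x) ^ j) sums 0" "x \<noteq> 0"
  shows "poly (horner_poly c k) x = - (\<Sum>i. c (i + Suc k) * (1 / x) ^ Suc i)"
proof -
  have "(\<Sum>i. c (i + Suc k) * (1 / x) ^ (i + Suc k)) = - (\<Sum>j\<le>k. c j * (1 / x) ^ j)"
    using suminf_split_initial_segment [OF sums_summable [OF assms(1)], of "Suc k"] sums_unique [OF assms(1)]
    by (simp add: lessThan_Suc_atMost eq_neg_iff_add_eq_0)
  moreover have "(\<Sum>i. c (i + Suc k) * (1 / x) ^ Suc i) = x ^ k * (\<Sum>i. c (i + Suc k) * (1 / x) ^ (i + Suc k))"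
  proof (subst suminf_mult [symmetric])
    show "summable (\<lambda>i. c (i + Suc k) * (1 / x) ^ (i + Suc k))"
      using sums_summable [OF assms(1)] by (rule summable_ignore_initial_segment)
    show "(\<Sum>i. c (i + Suc k) * (1 / x) ^ Suc i) = (\<Sum>i. x ^ k * (c (i + Suc k) * (1 / x) ^ (i + Suc k)))"
      using assms(2) by (intro suminf_cong) (simp add: power_add field_simps)
  qed
  ultimately show ?thesis using poly_horner_poly [OF assms(2), of c k] by simp
qed

text \<open>At \<open>x\<close> the Horner values at \<open>m\<close> and \<open>m + q\<close>
  agree, because the tails do. This is a rational polynomial equation, so it holds at
  \<open>z\<close>, where the recursion then keeps the Horner values constant along
  \<open>m + i * q\<close>. The partial sums there are this constant over growing powers of
  \<open>z\<close>, hence tend to 0.\<close>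

lemma sign_series_conjugate_root:
  fixes a :: "nat \<Rightarrow> real" and x z :: complex
  assumes conj: "galois_conjugate z x"
    and a: "\<And>j. a j = 1 \<or> a j = -1"
    and per: "q > 0" "\<And>j. j > m \<Longrightarrow> a (j + q) = a j"
    and x: "x \<noteq> 0" "(\<lambda>j. of_real (a j) * (1 / x) ^ j) sums 0"
    and z: "cmod z > 1"
  shows "(\<lambda>j. of_real (a j) * (1 / z) ^ j) sums 0"
proof -
  define b :: "nat \<Rightarrow> rat" where "b j = (if a j = 1 then 1 else -1)" for j
  define c :: "nat \<Rightarrow> complex" where "c j = of_real (a j)" for j
  have bc: "of_rat (b j) = c j" for j using a [of j] by (auto simp: b_def c_def)
  have perc: "c (j + q) = c j" if "j > m" for j using per(2) that by (simp add: c_def)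
  define Q where "Q = horner_poly b (m + q) - horner_poly b m"
  have Q: "poly (map_poly of_rat Q) y = poly (horner_poly c (m + q)) y - poly (horner_poly c m) y" for y
    by (simp add: Q_def map_poly_of_rat_diff map_poly_horner_poly bc)
  have "poly (map_poly of_rat Q) x = 0"
  proof -
    have "c (i + Suc (m + q)) = c (i + Suc m)" for i
      using perc [of "i + Suc m"] by (simp add: add_ac)
    then show ?thesis unfolding Q using x by (simp add: horner_poly_eq_tail c_def [symmetric])
  qed
  then have "poly (map_poly of_rat Q) z = 0" by (rule galois_conjugate_root [OF conj])
  then have Qz: "poly (horner_poly c (m + q)) z = poly (horner_poly c m) z" unfolding Q by simp
  have z0: "z \<noteq> 0" using z by auto
  define C where "C = poly (horner_poly c m) z"
  define p where "p k = (\<Sum>j\<le>k. c j * (1 / z) ^ j)" for k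
  have p: "p (m + i * q) = C * (1 / z) ^ (m + i * q)" for i
    using horner_poly_eventually_periodic [of m c q z i] perc Qz poly_horner_poly [OF z0, of c "m + i * q"] z0
    by (simp add: C_def p_def field_simps)
  have norm1: "norm (1 / z) < 1" using z z0 by (simp add: norm_divide field_simps)
  have "summable (\<lambda>j. c j * (1 / z) ^ j)"
  proof (rule summable_comparison_test')
    show "summable (\<lambda>j. norm (1 / z) ^ j)" using norm1 by (simp add: summable_geometric)
    show "norm (c j * (1 / z) ^ j) \<le> norm (1 / z) ^ j" for j
      using a [of j] by (auto simp: c_def norm_mult norm_power norm_divide)
  qed
  then obtain s where s: "(\<lambda>j. c j * (1 / z) ^ j) sums s" by (auto simp: summable_def)
  then have "p \<longlonglongrightarrow> s" unfolding sums_def_le p_def .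
  moreover have sub: "strict_mono (\<lambda>i. m + i * q)" using per(1) by (simp add: strict_mono_def)
  ultimately have "(\<lambda>i. p (m + i * q)) \<longlonglongrightarrow> s" by (rule LIMSEQ_subseq_LIMSEQ [unfolded o_def])
  moreover have "(\<lambda>i. p (m + i * q)) \<longlonglongrightarrow> C * 0"
    unfolding p using LIMSEQ_subseq_LIMSEQ [OF LIMSEQ_power_zero [OF norm1] sub]
    by (intro tendsto_intros) (simp add: o_def)
  ultimately have "s = 0" using LIMSEQ_unique by fastforce
  then show ?thesis using s by (simp add: c_def)
qed

section \<open>Branches and jumps\<close>

text \<open>The branches are the closed intervals from a point of \<open>insert 0 T\<close> to the
  next point of \<open>insert 1 T\<close>, so they are counted by their left endpoints.\<close>

lemma card_branches:
  fixes g :: "real \<Rightarrow> real"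
  assumes fin: "finite T" and T: "T \<subseteq> {0<..<1}"
    and mono: "\<And>x y. 0 \<le> x \<Longrightarrow> x < y \<Longrightarrow> y \<le> 1 \<Longrightarrow> T \<inter> {x<..<y} = {} \<Longrightarrow>
      mono_on {x..y} g \<or> antimono_on {x..y} g"
    and turn: "\<And>t x y. t \<in> T \<Longrightarrow> 0 \<le> x \<Longrightarrow> x < t \<Longrightarrow> t < y \<Longrightarrow> y \<le> 1 \<Longrightarrow>
      \<not> (mono_on {x..y} g \<or> antimono_on {x..y} g)"
  shows "card (branches g) = Suc (card T)"
proof -
  define nxt where "nxt u = Min {v \<in> insert 1 T. u < v}" for u
  have nxt: "nxt u \<in> insert 1 T" "u < nxt u" "T \<inter> {u<..<nxt u} = {}" if "u < 1" for u
  proof -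
    have "finite {v \<in> insert 1 T. u < v}" "{v \<in> insert 1 T. u < v} \<noteq> {}" using fin that by auto
    note Min_in [OF this] Min_le [OF this(1)]
    then show "nxt u \<in> insert 1 T" "u < nxt u" "T \<inter> {u<..<nxt u} = {}"
      by (auto simp: nxt_def not_less [symmetric])
  qed
  have T01: "0 < t" "t < 1" if "t \<in> T" for t using T that by auto
  have nxt01: "0 \<le> u" "u < 1" "u < nxt u" "nxt u \<le> 1" if "u \<in> insert 0 T" for u
  proof -
    show u: "0 \<le> u" "u < 1" using that T01 [of u] by auto
    show "u < nxt u" "nxt u \<le> 1" using nxt(1,2) [OF u(2)] T01 [of "nxt u"] by auto
  qed
  have sub: "mono_on J g \<or> antimono_on J g" if "mono_on K g \<or> antimono_on K g" "J \<subseteq> K" for J K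
    using that by (meson monotone_on_subset)
  have no_turn: False if K: "monotone_interval g K" and "t \<in> T" "x \<in> K" "y \<in> K" "x < t" "t < y" for K t x y
  proof -
    have "{x..y} \<subseteq> K" using K that unfolding monotone_interval_def is_interval_1
      by (meson atLeastAtMost_iff subsetI)
    moreover have "0 \<le> x" "y \<le> 1" using K that by (auto simp: monotone_interval_def)
    ultimately show False using turn [of t x y] that K sub [of K "{x..y}"] by (auto simp: monotone_interval_def)
  qed
  have piece: "monotone_interval g {u..nxt u}" if "u \<in> insert 0 T" for u
    using nxt01 [OF that] nxt(3) [of u] mono [of u "nxt u"]
    by (auto simp: monotone_interval_def is_interval_cc)
  \<comment> \<open>The piece is the one that starts at the last point of \<open>insert 0 T\<close>
    not beyond \<open>Inf K\<close>; reaching past its end would put a turning point inside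
    \<open>K\<close>.\<close>
  have cover: "\<exists>u\<in>insert 0 T. K \<subseteq> {u..nxt u}" if K: "monotone_interval g K" "K \<noteq> {}" for K
  proof -
    have bdd: "bdd_below K" using K by (auto simp: monotone_interval_def intro!: bdd_belowI [of _ 0])
    have inf0: "0 \<le> Inf K" using K by (intro cInf_greatest) (auto simp: monotone_interval_def)
    define u where "u = Max {v \<in> insert 0 T. v \<le> Inf K}"
    have fin': "finite {v \<in> insert 0 T. v \<le> Inf K}" "{v \<in> insert 0 T. v \<le> Inf K} \<noteq> {}" using fin inf0 by auto
    have u: "u \<in> insert 0 T" "u \<le> Inf K" using Max_in [OF fin'] by (auto simp: u_def)
    have above: "v \<le> u" if "v \<in> T" "v \<le> Inf K" for v
      unfolding u_def using that fin' by (intro Max_ge) auto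
    have "x \<le> nxt u" if x: "x \<in> K" for x
    proof (rule ccontr)
      assume "\<not> x \<le> nxt u"
      then have lt: "nxt u < x" by simp
      have "x \<le> 1" using K x by (auto simp: monotone_interval_def)
      then have tT: "nxt u \<in> T" using nxt(1) [of u] nxt01(2) [OF u(1)] lt by auto
      have "Inf K < nxt u" using above [OF tT] nxt01(3) [OF u(1)] by linarith
      then obtain y where "y \<in> K" "y < nxt u" using cInf_less_iff [OF K(2) bdd] by auto
      then show False using no_turn [OF K(1) tT _ x] lt by blast
    qed
    moreover have "u \<le> x" if "x \<in> K" for x using u(2) cInf_lower [OF that bdd] by linarith
    ultimately show ?thesis using u(1) by (intro bexI [of _ u]) auto
  qed
  have "branches g = (\<lambda>u. {u..nxt u}) ` insert 0 T"
  proof (intro equalityI subsetI)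
    fix J assume J: "J \<in> branches g"
    have mi: "monotone_interval g J" and max: "\<And>K. monotone_interval g K \<Longrightarrow> J \<subseteq> K \<Longrightarrow> K = J"
      using J by (auto simp: branches_def)
    \<comment> \<open>The empty set counts as a monotone interval, but it is not maximal.\<close>
    have "J \<noteq> {}" using max [OF piece [of 0]] nxt01 [of 0] by auto
    then obtain u where "u \<in> insert 0 T" "J \<subseteq> {u..nxt u}" using cover [OF mi] by blast
    then show "J \<in> (\<lambda>u. {u..nxt u}) ` insert 0 T" using max [OF piece] by blast
  next
    fix J assume "J \<in> (\<lambda>u. {u..nxt u}) ` insert 0 T"
    then obtain u where u: "u \<in> insert 0 T" and J: "J = {u..nxt u}" by auto
    have "K = J" if K: "monotone_interval g K" "J \<subseteq> K" for K
    proof -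
      have ends: "u \<in> K" "nxt u \<in> K" using K(2) J nxt01 [OF u] by auto
      have "x \<in> J" if x: "x \<in> K" for x
      proof -
        have x01: "0 \<le> x" "x \<le> 1" using K x by (auto simp: monotone_interval_def)
        have "u \<le> x"
        proof (rule ccontr)
          assume "\<not> u \<le> x"
          moreover from this have "u \<in> T" using u x01 by auto
          ultimately show False using no_turn [OF K(1) _ x ends(2), of u] nxt01(3) [OF u] by auto
        qed
        moreover have "x \<le> nxt u"
        proof (rule ccontr)
          assume "\<not> x \<le> nxt u"
          moreover from this have "nxt u \<in> T" using nxt(1) [of u] nxt01(2) [OF u] x01 by auto
          ultimately show False using no_turn [OF K(1) _ ends(1) x, of "nxt u"] nxt01(3) [OF u] by auto
        qed
        ultimately show ?thesis by (simp add: J)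
      qed
      then show ?thesis using K(2) by blast
    qed
    then show "J \<in> branches g" using piece [OF u] J by (auto simp: branches_def)
  qed
  moreover have "inj_on (\<lambda>u. {u..nxt u}) (insert 0 T)"
    using nxt01(3) by (intro inj_onI) (simp add: Icc_eq_Icc less_imp_le)
  moreover have "0 \<notin> T" using T01 by blast
  ultimately show ?thesis using fin by (simp add: card_image)
qed

text \<open>The left-hand side telescopes to the difference of the values of \<open>w\<close> near the two endpoints.\<close>

lemma sum_jumps_le:
  fixes w L R :: "real \<Rightarrow> real"
  assumes fin: "finite P" and P: "P \<subseteq> {0<..<1}"
    and L: "\<And>x. 0 < x \<Longrightarrow> x < 1 \<Longrightarrow> \<forall>\<^sub>F y in at_left x. w y = L x"
    and R: "\<And>x. 0 < x \<Longrightarrow> x < 1 \<Longrightarrow> \<forall>\<^sub>F y in at_right x. w y = R x"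
    and LR: "\<And>x. x \<notin> P \<Longrightarrow> L x = R x"
    and B: "\<And>y. \<bar>w y\<bar> \<le> B"
  shows "\<bar>\<Sum>p\<in>P. R p - L p\<bar> \<le> 2 * B"
proof -
  define J where "J p = R p - L p" for p
  \<comment> \<open>Removing the accumulated jumps from the right-hand values leaves a locally
    constant function, which is constant on the connected open interval.\<close>
  define g where "g x = R x - (\<Sum>p\<in>P \<inter> {..x}. J p)" for x
  have Rval: "\<exists>y. R x = w y" if "0 < x" "x < 1" for x
    using eventually_happens [OF R [OF that]] by (auto intro: sym)
  have RB: "\<bar>R x\<bar> \<le> B" if "0 < x" "x < 1" for x
    using Rval [OF that] B by auto
  have Req: "R y = v" if "0 < y" "y < 1" "a \<le> y" "y < b" "\<And>z. a < z \<Longrightarrow> z < b \<Longrightarrow> w z = v" for y v a b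
  proof -
    have "\<forall>\<^sub>F z in at_right y. w z = R y \<and> z \<in> {y<..<b}"
      using R [OF that(1,2)] eventually_at_right_real [OF that(4)] by eventually_elim auto
    then obtain z where "w z = R y" "y < z" "z < b" using eventually_happens by fastforce
    then show ?thesis using that by auto
  qed
  have away: "\<exists>d>0. \<forall>p\<in>P. p \<noteq> x \<longrightarrow> d \<le> \<bar>p - x\<bar>" for x
    using finite_set_avoid [OF fin, of x] by (auto simp: dist_real_def abs_minus_commute)
  have local: "\<forall>\<^sub>F y in at x within {0<..<1}. g x = g y" if x: "x \<in> {0<..<1}" for x
  proof -
    have x01: "0 < x" "x < 1" using x by auto
    obtain d where d: "d > 0" "\<And>p. p \<in> P \<Longrightarrow> p \<noteq> x \<Longrightarrow> d \<le> \<bar>p - x\<bar>" using away by blast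
    obtain a where a: "a < x" "\<And>z. a < z \<Longrightarrow> z < x \<Longrightarrow> w z = L x"
      using L [OF x01] unfolding eventually_at_left_field by blast
    obtain b where b: "b > x" "\<And>z. x < z \<Longrightarrow> z < b \<Longrightarrow> w z = R x"
      using R [OF x01] unfolding eventually_at_right_field by blast
    have "g x = g y" if y: "y \<in> {0<..<1}" "y \<noteq> x" "\<bar>y - x\<bar> < min d (min (x - a) (b - x))" for y
    proof (cases "y > x")
      case True
      have "R y = R x" using y True b(2) by (intro Req [of y x b]) auto
      moreover have "P \<inter> {..x} = P \<inter> {..y}" using d(2) y True by force
      ultimately show ?thesis by (simp add: g_def)
    next
      case False
      have "R y = L x" using y False a(2) by (intro Req [of y a x]) auto
      moreover have "(\<Sum>p\<in>P \<inter> {..x}. J p) = (\<Sum>p\<in>P \<inter> {..y}. J p) + J x"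
      proof (cases "x \<in> P")
        case True
        have "P \<inter> {..x} = insert x (P \<inter> {..y})" using d(2) y False True by force
        then show ?thesis using fin y False by (simp add: add.commute)
      next
        case notP: False
        have "P \<inter> {..x} = P \<inter> {..y}" using d(2) y False notP by force
        then show ?thesis using LR [OF notP] by (simp add: J_def)
      qed
      ultimately show ?thesis by (simp add: g_def J_def)
    qed
    then show ?thesis
      unfolding eventually_at using a b d
      by (intro exI [of _ "min d (min (x - a) (b - x))"]) (auto simp: dist_real_def)
  qed
  \<comment> \<open>The point \<open>1/2\<close> keeps \<open>F\<close> nonempty when
    \<open>P\<close> is empty; \<open>a\<close> and \<open>b\<close> then lie in the open interval,
    left and right of all jumps.\<close>
  define F where "F = insert (1/2) P"
  define a b where "a = Min F / 2" and "b = (Max F + 1) / 2"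
  have F: "finite F" "F \<noteq> {}" "F \<subseteq> {0<..<1}" using fin P by (auto simp: F_def)
  have MF: "0 < Min F" "Min F < 1" "0 < Max F" "Max F < 1"
    using Min_in [OF F(1,2)] Max_in [OF F(1,2)] F(3) by auto
  have ab: "a \<in> {0<..<1}" "b \<in> {0<..<1}" using MF by (auto simp: a_def b_def)
  have "P \<inter> {..a} = {}" "P \<inter> {..b} = P"
  proof -
    have "a < p \<and> p \<le> b" if "p \<in> P" for p
    proof -
      have "Min F \<le> p" "p \<le> Max F" using that F(1) by (simp_all add: F_def)
      then show ?thesis using MF by (simp add: a_def b_def field_simps)
    qed
    then show "P \<inter> {..a} = {}" "P \<inter> {..b} = P" by force+
  qed
  then have "g a = R a" "g b = R b - (\<Sum>p\<in>P. J p)" by (simp_all add: g_def)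
  moreover have "g a = g b" using local ab by (intro connected_local_const [of "{0<..<1}"]) auto
  ultimately have "(\<Sum>p\<in>P. J p) = R b - R a" by simp
  then show ?thesis using RB [of a] RB [of b] ab by (simp add: J_def)
qed

section \<open>Kneading theory of a map with one turning point\<close>

text \<open>The sign \<open>e\<close> is the direction of \<open>f\<close> left of \<open>c\<close>.
  Phrasing strict monotonicity through \<open>sgn\<close> treats both orientations at once and makes
  signs multiply under composition.\<close>

locale turning_map =
  fixes f :: "real \<Rightarrow> real" and c e :: real
  assumes cont: "continuous_on {0..1} f"
    and maps: "\<And>x. x \<in> {0..1} \<Longrightarrow> f x \<in> {0..1}"
    and c01: "0 < c" "c < 1"
    and e_sign: "e = 1 \<or> e = -1"
    and left: "\<And>x y. x \<in> {0..c} \<Longrightarrow> y \<in> {0..c} \<Longrightarrow> sgn (f y - f x) = e * sgn (y - x)"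
    and right: "\<And>x y. x \<in> {c..1} \<Longrightarrow> y \<in> {c..1} \<Longrightarrow> sgn (f y - f x) = - e * sgn (y - x)"
begin

lemma c_in: "c \<in> {0..1}" using c01 by auto

lemma e_sq [simp]: "e * e = 1" "e * (e * x) = x" using e_sign by auto

lemma iter_in: "x \<in> {0..1} \<Longrightarrow> (f ^^ n) x \<in> {0..1}"
  by (induction n) (simp_all only: funpow.simps id_apply comp_apply maps)

lemma cont_iter: "continuous_on {0..1} (f ^^ n)"
proof (induction n)
  case (Suc n)
  have "continuous_on ((f ^^ n) ` {0..1}) f"
    using iter_in by (intro continuous_on_subset [OF cont]) auto
  then show ?case using continuous_on_compose [OF Suc] by (simp add: comp_def)
qed simp

section \<open>Turning points of the iterates\<close>

text \<open>The cardinality of \<open>hits j\<close> is the coefficient \<open>g j\<close> of the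
  generating function.\<close>

definition hits :: "nat \<Rightarrow> real set" where
  "hits j = {x \<in> {0<..<1}. (f ^^ j) x = c \<and> (\<forall>i<j. (f ^^ i) x \<noteq> c)}"

definition turns :: "nat \<Rightarrow> real set" where
  "turns n = {x \<in> {0<..<1}. \<exists>j<n. (f ^^ j) x = c}"

lemma turns_subset: "turns n \<subseteq> {0<..<1}" by (auto simp: turns_def)

lemma turns_Un_hits: "turns n = (\<Union>j<n. hits j)"
proof (intro equalityI subsetI)
  fix x assume "x \<in> turns n"
  then obtain j where x: "x \<in> {0<..<1}" "j < n" "(f ^^ j) x = c" by (auto simp: turns_def)
  define i where "i = (LEAST i. (f ^^ i) x = c)"
  have "(f ^^ i) x = c" "i \<le> j" "\<And>k. k < i \<Longrightarrow> (f ^^ k) x \<noteq> c"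
    unfolding i_def using x(3) by (auto intro: LeastI Least_le dest: not_less_Least)
  then show "x \<in> (\<Union>j<n. hits j)" using x by (auto simp: hits_def intro!: bexI [of _ i])
qed (auto simp: turns_def hits_def)

lemma hits_disjoint: "i \<noteq> j \<Longrightarrow> hits i \<inter> hits j = {}"
  by (cases i j rule: linorder_cases) (auto simp: hits_def)

text \<open>\<open>f\<close> is injective on each side of \<open>c\<close>, so finiteness survives
  each step backwards.\<close>

lemma finite_preimage: "finite {x \<in> {0..1}. (f ^^ j) x = y}"
proof (induction j arbitrary: y)
  case 0
  have "{x \<in> {0..1}. (f ^^ 0) x = y} \<subseteq> {y}" by auto
  then show ?case using finite_subset by blast
next
  case (Suc j)
  define A where "A = {x \<in> {0..1}. (f ^^ j) x = y}"
  have A: "finite A" unfolding A_def by (rule Suc)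
  have inj: "inj_on f {0..c}" "inj_on f {c..1}"
  proof (rule inj_onI)
    show "x = y" if "x \<in> {0..c}" "y \<in> {0..c}" "f x = f y" for x y
      using left [OF that(1,2)] that(3) e_sign by (auto simp: sgn_0_0)
  next
    show "inj_on f {c..1}"
    proof (rule inj_onI)
      show "x = y" if "x \<in> {c..1}" "y \<in> {c..1}" "f x = f y" for x y
        using right [OF that(1,2)] that(3) e_sign by (auto simp: sgn_0_0)
    qed
  qed
  have "{x \<in> {0..1}. (f ^^ Suc j) x = y} \<subseteq> (f -` A \<inter> {0..c}) \<union> (f -` A \<inter> {c..1})"
  proof
    fix x assume "x \<in> {x \<in> {0..1}. (f ^^ Suc j) x = y}"
    then have x: "x \<in> {0..1}" "(f ^^ j) (f x) = y" by (simp_all add: funpow_Suc_right del: funpow.simps)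
    then have "f x \<in> A" using maps [of x] by (simp add: A_def)
    then show "x \<in> (f -` A \<inter> {0..c}) \<union> (f -` A \<inter> {c..1})" using x(1) by (cases "x \<le> c") auto
  qed
  moreover have "finite ((f -` A \<inter> {0..c}) \<union> (f -` A \<inter> {c..1}))"
    using finite_vimage_IntI [OF A inj(1)] finite_vimage_IntI [OF A inj(2)] by simp
  ultimately show ?case by (rule finite_subset)
qed

lemma finite_hits: "finite (hits j)"
  by (rule finite_subset [OF _ finite_preimage [of j c]]) (auto simp: hits_def)

lemma finite_turns: "finite (turns n)"
  using finite_hits by (simp add: turns_Un_hits)

lemma card_turns: "card (turns n) = (\<Sum>j<n. card (hits j))"
  unfolding turns_Un_hits by (intro card_UN_disjoint) (use finite_hits hits_disjoint in blast)+

section \<open>Slope signs along orbits\<close>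

definition side :: "real \<Rightarrow> real" where
  "side x = (if x < c then e else - e)"

text \<open>The value given to the slope sign at \<open>c\<close> is immaterial unless \<open>c\<close> is periodic. In that case
  it is the slope sign, close to \<open>c\<close>, at the first return to \<open>c\<close>; as the return map has a strict
  extremum at \<open>c\<close>, this is the same from both sides.\<close>

definition centre_sign :: real where
  "centre_sign = (if \<exists>p>0. (f ^^ p) c = c
     then \<Prod>i<(LEAST p. p > 0 \<and> (f ^^ p) c = c) - 1. side ((f ^^ Suc i) c) else 1)"

definition slope :: "real \<Rightarrow> real" where
  "slope x = (if x = c then centre_sign else side x)"

definition slope_prod :: "nat \<Rightarrow> real \<Rightarrow> real" where
  "slope_prod n x = (\<Prod>i<n. slope ((f ^^ i) x))"

text \<open>These are the coefficients of the Milnor-Thurston kneading determinant, the sequence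
  \<open>a\<close> of the outline.\<close>

definition kneading :: "nat \<Rightarrow> real" where
  "kneading n = slope_prod n (f c)"

lemma prod_sign: "(\<And>i. i \<in> A \<Longrightarrow> g i = 1 \<or> g i = -1) \<Longrightarrow> prod g A = 1 \<or> prod g A = (-1 :: real)"
proof (induction A rule: infinite_finite_induct)
  case (insert x F)
  then have "g x = 1 \<or> g x = -1" "prod g F = 1 \<or> prod g F = -1" by blast+
  then show ?case using insert.hyps by auto
qed auto

lemma side_sign: "side x = 1 \<or> side x = -1"
  using e_sign by (auto simp: side_def)

lemma centre_sign_sign: "centre_sign = 1 \<or> centre_sign = -1"
proof -
  have "(\<Prod>i<n. side ((f ^^ Suc i) c)) = 1 \<or> (\<Prod>i<n. side ((f ^^ Suc i) c)) = -1" for n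
    by (rule prod_sign) (rule side_sign)
  then show ?thesis unfolding centre_sign_def by presburger
qed

lemma slope_sign: "slope x = 1 \<or> slope x = -1"
  using side_sign [of x] centre_sign_sign by (simp add: slope_def)

lemma slope_prod_sign: "slope_prod n x = 1 \<or> slope_prod n x = -1"
  unfolding slope_prod_def by (rule prod_sign) (rule slope_sign)

lemma kneading_sign: "kneading n = 1 \<or> kneading n = -1"
  unfolding kneading_def by (rule slope_prod_sign)

lemma slope_prod_add: "slope_prod (m + n) x = slope_prod m x * slope_prod n ((f ^^ m) x)"
proof (induction n)
  case (Suc n)
  have "(f ^^ (m + n)) x = (f ^^ n) ((f ^^ m) x)" using funpow_add [of n m f] by (simp add: add.commute)
  with Suc show ?case by (simp add: slope_prod_def)
qed (simp add: slope_prod_def)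

lemma slope_prod_1 [simp]: "slope_prod (Suc 0) x = slope x"
  by (simp add: slope_prod_def)

section \<open>Local behaviour of the iterates\<close>

lemma slope_off_centre: "x \<noteq> c \<Longrightarrow> slope x = - e * sgn (x - c)"
  by (auto simp: slope_def side_def)

lemma sgn_centre: "x \<in> {0..1} \<Longrightarrow> x \<noteq> c \<Longrightarrow> sgn (f x - f c) = - e"
  using left [of c x] right [of c x] c01 by (cases "x < c") auto

lemma slope_locally_const:
  assumes "w \<noteq> c" "\<bar>u - w\<bar> < \<bar>w - c\<bar>"
  shows "slope u = slope w" "u \<noteq> c"
proof -
  have "w < c \<and> u < c \<or> c < w \<and> c < u" using assms by (auto simp: abs_if split: if_splits)
  then show "slope u = slope w" "u \<noteq> c" by (auto simp: slope_def side_def)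
qed

lemma sgn_local:
  assumes "w \<in> {0..1}" "u \<in> {0..1}" "w \<noteq> c" "\<bar>u - w\<bar> < \<bar>w - c\<bar>"
  shows "sgn (f u - f w) = slope w * sgn (u - w)"
proof -
  have "w < c \<and> u < c \<or> c < w \<and> c < u" using assms(3,4) by (auto simp: abs_if split: if_splits)
  then show ?thesis using left [of w u] right [of w u] assms by (auto simp: slope_def side_def)
qed

lemma iter_close:
  assumes "x \<in> {0..1}" "d > 0"
  shows "\<forall>\<^sub>F y in at x within {0..1}. (f ^^ n) y \<in> {0..1} \<and> \<bar>(f ^^ n) y - (f ^^ n) x\<bar> < d"
proof -
  have "((f ^^ n) \<longlongrightarrow> (f ^^ n) x) (at x within {0..1})"
    using cont_iter assms(1) by (auto simp: continuous_on_def)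
  then have "\<forall>\<^sub>F y in at x within {0..1}. dist ((f ^^ n) y) ((f ^^ n) x) < d"
    using assms(2) by (rule tendstoD)
  moreover have "\<forall>\<^sub>F y in at x within {0..1}. y \<in> {0..1}" by (simp add: eventually_at_filter)
  ultimately show ?thesis by eventually_elim (use iter_in in \<open>auto simp: dist_real_def\<close>)
qed

text \<open>A chain rule for signs: while the orbit avoids \<open>c\<close>, each application of
  \<open>f\<close> multiplies the sign of the displacement by the slope sign.\<close>

lemma slope_prod_orientation:
  assumes x: "x \<in> {0..1}" and "\<And>i. i < n \<Longrightarrow> (f ^^ i) x \<noteq> c"
  shows "\<forall>\<^sub>F y in at x within {0..1}. sgn ((f ^^ n) y - (f ^^ n) x) = slope_prod n x * sgn (y - x)"
  using assms(2)
proof (induction n)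
  case (Suc n)
  let ?w = "(f ^^ n) x"
  have w: "?w \<noteq> c" using Suc.prems by simp
  have "\<forall>\<^sub>F y in at x within {0..1}. sgn ((f ^^ n) y - ?w) = slope_prod n x * sgn (y - x)"
    using Suc by simp
  moreover have "\<forall>\<^sub>F y in at x within {0..1}. (f ^^ n) y \<in> {0..1} \<and> \<bar>(f ^^ n) y - ?w\<bar> < \<bar>?w - c\<bar>"
    using x w by (intro iter_close) auto
  ultimately show ?case
  proof eventually_elim
    case (elim y)
    then have "sgn (f ((f ^^ n) y) - f ?w) = slope ?w * sgn ((f ^^ n) y - ?w)"
      using sgn_local [OF iter_in [OF x] _ w] by blast
    then show ?case using elim by (simp add: slope_prod_def)
  qed
qed (simp add: slope_prod_def)

lemma slope_prod_local:
  assumes x: "x \<in> {0..1}" and "\<And>i. i < n \<Longrightarrow> (f ^^ i) x \<noteq> c"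
  shows "\<forall>\<^sub>F y in at x within {0..1}. slope_prod n y = slope_prod n x"
  using assms(2)
proof (induction n)
  case (Suc n)
  let ?w = "(f ^^ n) x"
  have w: "?w \<noteq> c" using Suc.prems by simp
  have "\<forall>\<^sub>F y in at x within {0..1}. slope_prod n y = slope_prod n x"
    by (rule Suc.IH) (rule Suc.prems, simp)
  moreover have "\<forall>\<^sub>F y in at x within {0..1}. (f ^^ n) y \<in> {0..1} \<and> \<bar>(f ^^ n) y - ?w\<bar> < \<bar>?w - c\<bar>"
    using x w by (intro iter_close) auto
  ultimately show ?case
  proof eventually_elim
    case (elim y)
    have "slope ((f ^^ n) y) = slope ?w"
      by (rule slope_locally_const(1) [OF w]) (rule conjunct2 [OF elim(2)])
    with elim(1) show ?case by (simp add: slope_prod_def)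
  qed
qed (simp add: slope_prod_def)

text \<open>Allows statements about punctured neighbourhoods of an image point to be pulled back
  along the iterate.\<close>

lemma filterlim_iter:
  assumes "x \<in> {0..1}" "\<forall>\<^sub>F y in at x within {0..1}. (f ^^ n) y \<noteq> (f ^^ n) x"
  shows "filterlim (f ^^ n) (at ((f ^^ n) x) within {0..1}) (at x within {0..1})"
  unfolding filterlim_at
proof (intro conjI)
  show "((f ^^ n) \<longlongrightarrow> (f ^^ n) x) (at x within {0..1})"
    using cont_iter assms(1) by (auto simp: continuous_on_def)
  show "\<forall>\<^sub>F y in at x within {0..1}. (f ^^ n) y \<in> {0..1} \<and> (f ^^ n) y \<noteq> (f ^^ n) x"
    using assms(2) iter_close [OF assms(1) zero_less_one] by eventually_elim blast
qed

text \<open>The first step folds both sides of \<open>c\<close> onto one side of \<open>f c\<close>;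
  the remaining \<open>p - 1\<close> steps avoid \<open>c\<close> and contribute exactly the product
  \<open>centre_sign\<close>.\<close>

lemma return_orientation:
  assumes p: "p > 0" "(f ^^ p) c = c" and first: "\<And>i. 0 < i \<Longrightarrow> i < p \<Longrightarrow> (f ^^ i) c \<noteq> c"
  shows "\<forall>\<^sub>F y in at c within {0..1}. sgn ((f ^^ p) y - c) = - e * centre_sign"
proof -
  obtain q where q: "p = Suc q" using p by (cases p) auto
  have fc: "f c \<in> {0..1}" using maps c_in by blast
  have iter_fc: "(f ^^ i) (f c) = (f ^^ Suc i) c" for i
    by (simp add: funpow_Suc_right del: funpow.simps)
  have nc: "(f ^^ i) (f c) \<noteq> c" if "i < q" for i
    using first [of "Suc i"] that q iter_fc by auto
  have least: "(LEAST p. p > 0 \<and> (f ^^ p) c = c) = p"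
  proof (rule Least_equality)
    show "p \<le> i" if "0 < i \<and> (f ^^ i) c = c" for i
      using first [of i] that by (cases "i < p") auto
  qed (use p in auto)
  have cs: "centre_sign = slope_prod q (f c)"
    unfolding centre_sign_def slope_prod_def least
    using p nc by (auto simp: q slope_def iter_fc intro!: prod.cong simp del: funpow.simps)
  have ne: "\<forall>\<^sub>F y in at c within {0..1}. y \<in> {0..1} \<and> y \<noteq> c" by (simp add: eventually_at_filter)
  have "filterlim (f ^^ 1) (at ((f ^^ 1) c) within {0..1}) (at c within {0..1})"
  proof (rule filterlim_iter [OF c_in])
    show "\<forall>\<^sub>F y in at c within {0..1}. (f ^^ 1) y \<noteq> (f ^^ 1) c"
      using ne
    proof eventually_elim
      case (elim y)
      then show ?case using sgn_centre [of y] e_sign by auto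
    qed
  qed
  then have lim: "filterlim f (at (f c) within {0..1}) (at c within {0..1})" by simp
  have "\<forall>\<^sub>F y in at c within {0..1}. sgn ((f ^^ q) (f y) - (f ^^ q) (f c)) = slope_prod q (f c) * sgn (f y - f c)"
    using slope_prod_orientation [OF fc nc] lim by (rule eventually_compose_filterlim)
  with ne show ?thesis
  proof eventually_elim
    case (elim y)
    have "(f ^^ q) (f y) = (f ^^ p) y" "(f ^^ q) (f c) = c"
      using p(2) by (simp_all add: q funpow_Suc_right del: funpow.simps)
    then show ?case using elim sgn_centre cs by simp
  qed
qed

text \<open>Away from \<open>c\<close> this is continuity. At the first return \<open>p\<close>,
  nearby points land on the side of \<open>c\<close> whose slope sign is \<open>centre_sign\<close>.
  For later returns the \<open>p\<close>-th iterate maps a punctured neighbourhood of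
  \<open>c\<close> into another one, and induction applies to \<open>k - p\<close>.\<close>

lemma slope_near_centre:
  "k > 0 \<Longrightarrow> \<forall>\<^sub>F y in at c within {0..1}. slope ((f ^^ k) y) = slope ((f ^^ k) c)"
proof (induction k rule: less_induct)
  case (less k)
  show ?case
  proof (cases "(f ^^ k) c = c")
    case False
    then have "\<forall>\<^sub>F y in at c within {0..1}. (f ^^ k) y \<in> {0..1} \<and> \<bar>(f ^^ k) y - (f ^^ k) c\<bar> < \<bar>(f ^^ k) c - c\<bar>"
      by (intro iter_close c_in) auto
    then show ?thesis
    proof eventually_elim
      case (elim y)
      show ?case by (rule slope_locally_const(1) [OF False]) (rule conjunct2 [OF elim])
    qed
  next
    case True
    define p where "p = (LEAST p. p > 0 \<and> (f ^^ p) c = c)"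
    have p: "p > 0" "(f ^^ p) c = c" "p \<le> k"
      using LeastI [of "\<lambda>p. p > 0 \<and> (f ^^ p) c = c" k] Least_le [of "\<lambda>p. p > 0 \<and> (f ^^ p) c = c" k]
        True less.prems by (auto simp: p_def)
    have "(f ^^ i) c \<noteq> c" if "0 < i" "i < p" for i
      using not_less_Least [of i "\<lambda>p. p > 0 \<and> (f ^^ p) c = c"] that by (auto simp: p_def)
    then have ret: "\<forall>\<^sub>F y in at c within {0..1}. sgn ((f ^^ p) y - c) = - e * centre_sign"
      by (intro return_orientation p)
    show ?thesis
    proof (cases "p = k")
      case True
      show ?thesis
        using ret
      proof eventually_elim
        case (elim y)
        then have "(f ^^ p) y \<noteq> c" using e_sign centre_sign_sign by auto
        then have "slope ((f ^^ p) y) = centre_sign" using elim by (simp add: slope_off_centre)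
        then show ?case using p True by (simp add: slope_def)
      qed
    next
      case False
      have "filterlim (f ^^ p) (at ((f ^^ p) c) within {0..1}) (at c within {0..1})"
      proof (rule filterlim_iter [OF c_in])
        show "\<forall>\<^sub>F y in at c within {0..1}. (f ^^ p) y \<noteq> (f ^^ p) c"
          using ret
        proof eventually_elim
          case (elim y)
          then show ?case using e_sign centre_sign_sign p(2) by auto
        qed
      qed
      then have lim: "filterlim (f ^^ p) (at c within {0..1}) (at c within {0..1})" by (simp add: p)
      have "\<forall>\<^sub>F y in at c within {0..1}. slope ((f ^^ (k - p)) y) = slope ((f ^^ (k - p)) c)"
        using less False p by simp
      then have "\<forall>\<^sub>F y in at c within {0..1}. slope ((f ^^ (k - p)) ((f ^^ p) y)) = slope ((f ^^ (k - p)) c)"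
        using lim by (rule eventually_compose_filterlim)
      moreover have split: "(f ^^ (k - p)) ((f ^^ p) y) = (f ^^ k) y" for y
        using p(3) funpow_add [of "k - p" p f] by simp
      moreover have "(f ^^ (k - p)) c = (f ^^ k) c" using split [of c] p(2) by simp
      ultimately show ?thesis by simp
    qed
  qed
qed

lemma slope_prod_near_centre:
  "\<forall>\<^sub>F y in at c within {0..1}. slope_prod n (f y) = kneading n"
proof -
  have "\<forall>\<^sub>F y in at c within {0..1}. \<forall>i\<in>{..<n}. slope ((f ^^ Suc i) y) = slope ((f ^^ Suc i) c)"
    by (rule eventually_ball_finite) (use slope_near_centre in \<open>auto simp del: funpow.simps\<close>)
  then show ?thesis
    by eventually_elim
       (auto simp: kneading_def slope_prod_def funpow_Suc_right simp del: funpow.simps intro!: prod.cong)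
qed

section \<open>Jumps of the slope sign and the Milnor-Thurston inequality\<close>

text \<open>The product splits at time \<open>j\<close>. The factor \<open>slope_prod j x\<close>
  occurs once before \<open>j\<close> and once in the side of \<open>c\<close> that is reached at
  time \<open>j\<close>; it cancels, so all jumps carry the common sign \<open>- e\<close>.\<close>

lemma slope_prod_jump:
  assumes x: "x \<in> hits j" and jk: "j \<le> k"
  shows "\<forall>\<^sub>F y in at x within {0..1}. slope_prod (Suc k) y = - e * kneading (k - j) * sgn (y - x)"
proof -
  have x01: "x \<in> {0..1}" and xj: "(f ^^ j) x = c" and nc: "\<And>i. i < j \<Longrightarrow> (f ^^ i) x \<noteq> c"
    using x by (auto simp: hits_def)
  have or: "\<forall>\<^sub>F y in at x within {0..1}. sgn ((f ^^ j) y - (f ^^ j) x) = slope_prod j x * sgn (y - x)"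
    and const: "\<forall>\<^sub>F y in at x within {0..1}. slope_prod j y = slope_prod j x"
    using slope_prod_orientation [of x j] slope_prod_local [of x j] x01 nc by blast+
  have ne: "\<forall>\<^sub>F y in at x within {0..1}. y \<noteq> x" by (simp add: eventually_at_filter)
  have "\<forall>\<^sub>F y in at x within {0..1}. (f ^^ j) y \<noteq> (f ^^ j) x"
    using or ne by eventually_elim (use slope_prod_sign [of j x] in \<open>auto simp: sgn_if split: if_splits\<close>)
  then have lim: "filterlim (f ^^ j) (at c within {0..1}) (at x within {0..1})"
    using filterlim_iter [OF x01, of j] xj by simp
  have "\<forall>\<^sub>F y in at x within {0..1}. slope_prod (k - j) (f ((f ^^ j) y)) = kneading (k - j)"
    using slope_prod_near_centre [of "k - j"] lim by (rule eventually_compose_filterlim)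
  with or const ne show ?thesis
  proof eventually_elim
    case (elim y)
    let ?u = "(f ^^ j) y"
    have "slope_prod (Suc k) y = slope_prod j y * slope_prod (Suc (k - j)) ?u"
      using slope_prod_add [of j "Suc (k - j)" y] jk by simp
    also have "slope_prod (Suc (k - j)) ?u = slope ?u * slope_prod (k - j) (f ?u)"
      using slope_prod_add [of "Suc 0" "k - j" ?u] by simp
    also have "slope ?u = - e * (slope_prod j x * sgn (y - x))"
    proof -
      have "?u \<noteq> c" using elim slope_prod_sign [of j x] xj by (auto simp: sgn_if split: if_splits)
      then show ?thesis using elim slope_off_centre xj by simp
    qed
    finally show ?case using elim slope_prod_sign [of j x] by auto
  qed
qed

text \<open>The step function \<open>slope_prod (Suc k)\<close> takes only the values 1 and -1, so
  its jumps, each twice a kneading sign up to the common factor \<open>- e\<close>, add up to at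
  most 2 in absolute value.\<close>

lemma card_hits_kneading_le: "\<bar>\<Sum>j\<le>k. real (card (hits j)) * kneading (k - j)\<bar> \<le> 1"
proof -
  define t where "t x = (THE j. x \<in> hits j)" for x
  have t: "t x = j" if "x \<in> hits j" for x j
    unfolding t_def
  proof (rule the_equality)
    show "i = j" if "x \<in> hits i" for i using that \<open>x \<in> hits j\<close> hits_disjoint [of i j] by auto
  qed (rule that)
  define P where "P = turns (Suc k)"
  define L where "L x = (if x \<in> P then e * kneading (k - t x) else slope_prod (Suc k) x)" for x
  define R where "R x = (if x \<in> P then - e * kneading (k - t x) else slope_prod (Suc k) x)" for x
  have sides: "(\<forall>\<^sub>F y in at_left x. slope_prod (Suc k) y = L x) \<and>
      (\<forall>\<^sub>F y in at_right x. slope_prod (Suc k) y = R x)" if x: "0 < x" "x < 1" for x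
  proof -
    have atx: "at x within {0..1} = at x" using x by (intro at_within_interior) simp
    have neq: "\<forall>\<^sub>F y in at_left x. y < x" "\<forall>\<^sub>F y in at_right x. x < y"
      by (simp_all add: eventually_at_filter)
    show ?thesis
    proof (cases "x \<in> P")
      case True
      then obtain j where j: "x \<in> hits j" "j \<le> k"
        by (auto simp: P_def turns_Un_hits less_Suc_eq_le)
      have "\<forall>\<^sub>F y in at x. slope_prod (Suc k) y = - e * kneading (k - j) * sgn (y - x)"
        using slope_prod_jump [OF j] atx by simp
      then have "\<forall>\<^sub>F y in at_left x. slope_prod (Suc k) y = - e * kneading (k - j) * sgn (y - x)"
        "\<forall>\<^sub>F y in at_right x. slope_prod (Suc k) y = - e * kneading (k - j) * sgn (y - x)"
        by (simp_all add: eventually_at_split)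
      note at_sides = this
      have LR: "L x = e * kneading (k - j)" "R x = - e * kneading (k - j)"
        using t [OF j(1)] True by (simp_all add: L_def R_def)
      have "\<forall>\<^sub>F y in at_left x. slope_prod (Suc k) y = L x"
        using at_sides(1) neq(1) by eventually_elim (simp add: LR)
      moreover have "\<forall>\<^sub>F y in at_right x. slope_prod (Suc k) y = R x"
        using at_sides(2) neq(2) by eventually_elim (simp add: LR)
      ultimately show ?thesis by blast
    next
      case False
      have "\<forall>\<^sub>F y in at x. slope_prod (Suc k) y = slope_prod (Suc k) x"
        using slope_prod_local [of x "Suc k"] False x atx by (auto simp: P_def turns_def)
      then show ?thesis using False by (simp add: L_def R_def eventually_at_split)
    qed
  qed
  have "\<bar>\<Sum>p\<in>P. R p - L p\<bar> \<le> 2 * 1"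
  proof (rule sum_jumps_le [where w = "slope_prod (Suc k)"])
    show "\<bar>slope_prod (Suc k) y\<bar> \<le> 1" for y using slope_prod_sign [of "Suc k" y] by auto
  qed (use sides finite_turns turns_subset in \<open>auto simp: P_def L_def R_def\<close>)
  also have "(\<Sum>p\<in>P. R p - L p) = (\<Sum>p\<in>P. - 2 * e * kneading (k - t p))"
    by (intro sum.cong) (auto simp: L_def R_def)
  also have "\<dots> = (\<Sum>j\<in>{..<Suc k}. \<Sum>p\<in>hits j. - 2 * e * kneading (k - t p))"
    unfolding P_def turns_Un_hits using finite_hits hits_disjoint by (intro sum.UNION_disjoint) auto
  also have "\<dots> = (\<Sum>j\<le>k. - 2 * e * (real (card (hits j)) * kneading (k - j)))"
    unfolding lessThan_Suc_atMost by (intro sum.cong) (auto simp: t)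
  also have "\<dots> = - 2 * e * (\<Sum>j\<le>k. real (card (hits j)) * kneading (k - j))"
    by (simp add: sum_distrib_left)
  finally show ?thesis using e_sign by (auto simp: abs_mult)
qed

section \<open>Counting the branches of the iterates\<close>

lemma iter_monotone_between_turns:
  assumes "0 \<le> x" "x \<le> y" "y \<le> 1" and "turns n \<inter> {x<..<y} = {}"
  shows "\<exists>d\<in>{1,-1}. \<forall>u\<in>{x..y}. \<forall>v\<in>{x..y}. sgn ((f ^^ n) v - (f ^^ n) u) = d * sgn (v - u)"
  using assms(4)
proof (induction n)
  case 0
  then show ?case by (intro bexI [of _ 1]) auto
next
  case (Suc n)
  let ?g = "f ^^ n"
  have "turns n \<subseteq> turns (Suc n)" unfolding turns_def using less_SucI by blast
  then have "turns n \<inter> {x<..<y} = {}" using Suc.prems by blast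
  then obtain d where d: "d = 1 \<or> d = -1"
    and g: "\<And>u v. u \<in> {x..y} \<Longrightarrow> v \<in> {x..y} \<Longrightarrow> sgn (?g v - ?g u) = d * sgn (v - u)"
    using Suc.IH by blast
  have no_centre: "?g u \<noteq> c" if "x < u" "u < y" for u
  proof
    assume "?g u = c"
    then have "u \<in> turns (Suc n)" using that assms by (auto simp: turns_def)
    then show False using Suc.prems that by auto
  qed
  have in01: "{x..y} \<subseteq> {0..1}" using assms by auto
  \<comment> \<open>By the intermediate value theorem, values on both sides of \<open>c\<close>
    would produce a visit to \<open>c\<close> strictly inside the interval.\<close>
  have same_side: False if u: "u \<in> {x..y}" "v \<in> {x..y}" "?g u < c" "c < ?g v" for u v
  proof -
    have "connected (?g ` closed_segment u v)"
    proof (rule connected_continuous_image)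
      have "closed_segment u v \<subseteq> {x..y}"
        using u by (intro closed_segment_subset) auto
      then show "continuous_on (closed_segment u v) ?g"
        using in01 continuous_on_subset [OF cont_iter] by blast
    qed auto
    then have "c \<in> ?g ` closed_segment u v"
      using u by (elim connectedD_interval [of _ "?g u" "?g v" c]) auto
    then obtain z where z: "z \<in> closed_segment u v" "?g z = c" by auto
    have "z \<noteq> u" "z \<noteq> v" using z u by auto
    then have "x < z" "z < y" using z(1) u by (auto simp: closed_segment_eq_real_ivl split: if_splits)
    then show False using no_centre z by blast
  qed
  have g01: "?g u \<in> {0..1}" if "u \<in> {x..y}" for u using iter_in in01 that by blast
  have "(\<forall>u\<in>{x..y}. ?g u \<in> {0..c}) \<or> (\<forall>u\<in>{x..y}. ?g u \<in> {c..1})"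
    using same_side g01 by (force simp: not_le)
  then show ?case
  proof
    assume "\<forall>u\<in>{x..y}. ?g u \<in> {0..c}"
    then show ?thesis
      using left g d e_sign by (intro bexI [of _ "e * d"]) auto
  next
    assume "\<forall>u\<in>{x..y}. ?g u \<in> {c..1}"
    then show ?thesis
      using right g d e_sign by (intro bexI [of _ "- e * d"]) auto
  qed
qed

text \<open>Valid also at \<open>w = c\<close>, because only one side of \<open>w\<close> is
  considered. Thus an extremum of an iterate stays a strict extremum even if its orbit meets
  \<open>c\<close> again.\<close>

lemma sgn_one_sided:
  assumes w: "w \<in> {0..1}" and d: "d = 1 \<or> d = -1"
  obtains d' r where "d' = 1 \<or> d' = -1" "r > 0"
    "\<And>u. u \<in> {0..1} \<Longrightarrow> \<bar>u - w\<bar> < r \<Longrightarrow> sgn (u - w) = d \<Longrightarrow> sgn (f u - f w) = d'"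
proof (cases "w = c")
  case True
  show thesis
  proof (rule that [of "- e" 1])
    show "sgn (f u - f w) = - e" if "u \<in> {0..1}" "sgn (u - w) = d" for u
    proof -
      have "u \<noteq> c" using that(2) True d by auto
      then show ?thesis using sgn_centre [OF that(1)] True by simp
    qed
  qed (use e_sign in auto)
next
  case False
  show thesis
  proof (rule that [of "slope w * d" "\<bar>w - c\<bar>"])
    show "slope w * d = 1 \<or> slope w * d = - 1" using slope_sign [of w] d by auto
    show "sgn (f u - f w) = slope w * d" if "u \<in> {0..1}" "\<bar>u - w\<bar> < \<bar>w - c\<bar>" "sgn (u - w) = d" for u
      using sgn_local [OF w that(1) False that(2)] that(3) by simp
  qed (use False in auto)
qed

text \<open>The first visit to \<open>c\<close> creates the extremum; from then on nearby points lie
  on one side of the orbit, and each further step preserves this.\<close>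

lemma turns_strict_extremum:
  assumes "t \<in> turns n"
  shows "\<exists>d\<in>{1,-1}. \<forall>\<^sub>F y in at t within {0..1}. sgn ((f ^^ n) y - (f ^^ n) t) = d"
proof -
  obtain j where jn: "j < n" and t: "t \<in> hits j" using assms by (auto simp: turns_Un_hits)
  have t01: "t \<in> {0..1}" and tj: "(f ^^ j) t = c" and nc: "\<And>i. i < j \<Longrightarrow> (f ^^ i) t \<noteq> c"
    using t by (auto simp: hits_def)
  have "Suc j \<le> n" using jn by simp
  then show ?thesis
  proof (induction n rule: dec_induct)
    case base
    have "\<forall>\<^sub>F y in at t within {0..1}. sgn ((f ^^ j) y - (f ^^ j) t) = slope_prod j t * sgn (y - t)"
      using slope_prod_orientation [of t j] t01 nc by blast
    moreover have "\<forall>\<^sub>F y in at t within {0..1}. y \<noteq> t \<and> y \<in> {0..1}" by (simp add: eventually_at_filter)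
    ultimately have "\<forall>\<^sub>F y in at t within {0..1}. sgn ((f ^^ Suc j) y - (f ^^ Suc j) t) = - e"
    proof eventually_elim
      case (elim y)
      then have "(f ^^ j) y \<noteq> c" using slope_prod_sign [of j t] tj by (auto simp: sgn_if split: if_splits)
      then show ?case using sgn_centre iter_in elim tj by simp
    qed
    then show ?case using e_sign by (intro bexI [of _ "- e"]) auto
  next
    case (step m)
    then obtain d where d: "d = 1 \<or> d = -1"
      and ev: "\<forall>\<^sub>F y in at t within {0..1}. sgn ((f ^^ m) y - (f ^^ m) t) = d" by blast
    obtain d' r where d': "d' = 1 \<or> d' = -1" "r > 0"
      "\<And>u. u \<in> {0..1} \<Longrightarrow> \<bar>u - (f ^^ m) t\<bar> < r \<Longrightarrow> sgn (u - (f ^^ m) t) = d \<Longrightarrow> sgn (f u - f ((f ^^ m) t)) = d'"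
      using sgn_one_sided [OF iter_in [OF t01] d] by metis
    have "\<forall>\<^sub>F y in at t within {0..1}. sgn ((f ^^ Suc m) y - (f ^^ Suc m) t) = d'"
      using ev iter_close [OF t01 d'(2), of m] by eventually_elim (use d'(3) in auto)
    then show ?case using d'(1) by blast
  qed
qed

lemma iter_not_monotone_at_turn:
  assumes t: "t \<in> turns n" and xy: "0 \<le> x" "x < t" "t < y" "y \<le> 1"
  shows "\<not> (mono_on {x..y} (f ^^ n) \<or> antimono_on {x..y} (f ^^ n))"
proof -
  obtain d where d: "d = 1 \<or> d = -1"
    and ev: "\<forall>\<^sub>F y in at t within {0..1}. sgn ((f ^^ n) y - (f ^^ n) t) = d"
    using turns_strict_extremum [OF t] by blast
  have "at t within {0..1} = at t" using xy by (intro at_within_interior) simp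
  then have sides: "\<forall>\<^sub>F u in at_left t. sgn ((f ^^ n) u - (f ^^ n) t) = d"
    "\<forall>\<^sub>F u in at_right t. sgn ((f ^^ n) u - (f ^^ n) t) = d"
    using ev by (simp_all add: eventually_at_split)
  have "\<forall>\<^sub>F u in at_left t. sgn ((f ^^ n) u - (f ^^ n) t) = d \<and> u \<in> {x<..<t}"
    using sides(1) eventually_at_left_real [OF xy(2)] by eventually_elim auto
  then obtain u where u: "sgn ((f ^^ n) u - (f ^^ n) t) = d" "x < u" "u < t"
    using eventually_happens by fastforce
  have "\<forall>\<^sub>F u in at_right t. sgn ((f ^^ n) u - (f ^^ n) t) = d \<and> u \<in> {t<..<y}"
    using sides(2) eventually_at_right_real [OF xy(3)] by eventually_elim auto
  then obtain v where v: "sgn ((f ^^ n) v - (f ^^ n) t) = d" "t < v" "v < y"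
    using eventually_happens by fastforce
  have mem: "u \<in> {x..y}" "t \<in> {x..y}" "v \<in> {x..y}" "u \<le> t" "t \<le> v" using u v xy by auto
  show ?thesis
  proof
    assume "mono_on {x..y} (f ^^ n) \<or> antimono_on {x..y} (f ^^ n)"
    then show False
    proof
      assume "mono_on {x..y} (f ^^ n)"
      then have "(f ^^ n) u \<le> (f ^^ n) t" "(f ^^ n) t \<le> (f ^^ n) v"
        using mem by (blast dest: monotone_onD)+
      then show False using u(1) v(1) d by (auto simp: sgn_if split: if_splits)
    next
      assume "antimono_on {x..y} (f ^^ n)"
      then have "(f ^^ n) t \<le> (f ^^ n) u" "(f ^^ n) v \<le> (f ^^ n) t"
        using mem by (blast dest: monotone_onD)+
      then show False using u(1) v(1) d by (auto simp: sgn_if split: if_splits)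
    qed
  qed
qed

lemma card_branches_iter: "card (branches (f ^^ n)) = Suc (card (turns n))"
proof (rule card_branches [OF finite_turns turns_subset])
  fix x y :: real assume xy: "0 \<le> x" "x < y" "y \<le> 1" "turns n \<inter> {x<..<y} = {}"
  obtain d where d: "d = 1 \<or> d = -1"
    and g: "\<And>u v. u \<in> {x..y} \<Longrightarrow> v \<in> {x..y} \<Longrightarrow> sgn ((f ^^ n) v - (f ^^ n) u) = d * sgn (v - u)"
    using iter_monotone_between_turns [OF xy(1) less_imp_le [OF xy(2)] xy(3,4)] by blast
  from d show "mono_on {x..y} (f ^^ n) \<or> antimono_on {x..y} (f ^^ n)"
  proof
    assume "d = 1"
    have "mono_on {x..y} (f ^^ n)"
    proof (rule mono_onI)
      fix u v assume "u \<in> {x..y}" "v \<in> {x..y}" "u \<le> v"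
      then show "(f ^^ n) u \<le> (f ^^ n) v" using g [of u v] \<open>d = 1\<close> by (auto simp: sgn_if split: if_splits)
    qed
    then show ?thesis ..
  next
    assume "d = -1"
    have "antimono_on {x..y} (f ^^ n)"
    proof (rule monotone_onI)
      fix u v assume "u \<in> {x..y}" "v \<in> {x..y}" "u \<le> v"
      then show "(f ^^ n) u \<ge> (f ^^ n) v" using g [of u v] \<open>d = -1\<close> by (auto simp: sgn_if split: if_splits)
    qed
    then show ?thesis ..
  qed
qed (use iter_not_monotone_at_turn in blast)

section \<open>Submultiplicativity and entropy\<close>

text \<open>The iterate is strictly monotone at \<open>x\<close>, so it takes values in the unit
  interval on both sides of its value at \<open>x\<close>. This matters because \<open>turns\<close>
  collects interior points only.\<close>

lemma iter_interior:
  assumes x: "x \<in> {0<..<1}" and "x \<notin> turns m"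
  shows "(f ^^ m) x \<in> {0<..<1}"
proof -
  have nc: "(f ^^ i) x \<noteq> c" if "i < m" for i using assms that by (auto simp: turns_def)
  have atx: "at x within {0..1} = at x" using x by (intro at_within_interior) simp
  have x01: "x \<in> {0..1}" using x by auto
  have "\<forall>\<^sub>F y in at x within {0..1}. sgn ((f ^^ m) y - (f ^^ m) x) = slope_prod m x * sgn (y - x) \<and> y \<in> {0..1}"
    using slope_prod_orientation [of x m, OF x01 nc]
    by (rule eventually_conj) (simp_all add: eventually_at_filter)
  then have sides: "\<forall>\<^sub>F y in at_left x. sgn ((f ^^ m) y - (f ^^ m) x) = slope_prod m x * sgn (y - x) \<and> y \<in> {0..1}"
    "\<forall>\<^sub>F y in at_right x. sgn ((f ^^ m) y - (f ^^ m) x) = slope_prod m x * sgn (y - x) \<and> y \<in> {0..1}"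
    by (simp_all only: atx eventually_at_split)
  have neq: "\<forall>\<^sub>F y in at_left x. y < x" "\<forall>\<^sub>F y in at_right x. x < y"
    by (simp_all add: eventually_at_filter)
  obtain u where u: "sgn ((f ^^ m) u - (f ^^ m) x) = - slope_prod m x" "u \<in> {0..1}"
    using eventually_happens [OF eventually_conj [OF sides(1) neq(1)]] by auto
  obtain v where v: "sgn ((f ^^ m) v - (f ^^ m) x) = slope_prod m x" "v \<in> {0..1}"
    using eventually_happens [OF eventually_conj [OF sides(2) neq(2)]] by auto
  show ?thesis
    using slope_prod_sign [of m x] u(1) v(1) iter_in [OF u(2), of m] iter_in [OF v(2), of m]
    by (auto simp: sgn_if split: if_splits)
qed

text \<open>A new turning point of the composite is mapped by the \<open>m\<close>-th iterate to one
  of the \<open>n\<close>-th. On each of the \<open>Suc (card (turns m))\<close> laps this map is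
  injective.\<close>

lemma card_turns_submult:
  "Suc (card (turns (m + n))) \<le> Suc (card (turns m)) * Suc (card (turns n))"
proof -
  define X where "X = {x \<in> {0<..<1}. x \<notin> turns m \<and> (f ^^ m) x \<in> turns n}"
  have sub: "turns (m + n) \<subseteq> turns m \<union> X"
  proof
    fix x assume x: "x \<in> turns (m + n)"
    show "x \<in> turns m \<union> X"
    proof (cases "x \<in> turns m")
      case False
      obtain j where j: "x \<in> {0<..<1}" "j < m + n" "(f ^^ j) x = c" using x by (auto simp: turns_def)
      have "m \<le> j" using False j by (auto simp: turns_def not_le [symmetric])
      then have "(f ^^ (j - m)) ((f ^^ m) x) = c" "j - m < n"
        using j funpow_add [of "j - m" m f] by auto
      then have "(f ^^ m) x \<in> turns n" using iter_interior [OF j(1) False] by (auto simp: turns_def)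
      then show ?thesis using False j(1) by (simp add: X_def)
    qed simp
  qed
  \<comment> \<open>The first component is the index of the lap containing \<open>x\<close>.\<close>
  define h where "h x = (card {t \<in> turns m. t < x}, (f ^^ m) x)" for x
  have aux: False if X: "x \<in> X" "y \<in> X" and eq: "h x = h y" and lt: "x < y" for x y
  proof -
    have "{t \<in> turns m. t < x} = {t \<in> turns m. t < y}"
      using eq lt finite_turns by (intro card_subset_eq) (auto simp: h_def)
    then have same: "t < x" if "t \<in> turns m" "t < y" for t using that by blast
    have no_turn: "turns m \<inter> {x<..<y} = {}" using same by fastforce
    have xy: "0 \<le> x" "x \<le> y" "y \<le> 1" "x \<in> {x..y}" "y \<in> {x..y}" using X lt by (auto simp: X_def)
    obtain d where "d \<in> {1, -1}" "sgn ((f ^^ m) y - (f ^^ m) x) = d * sgn (y - x)"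
      using iter_monotone_between_turns [OF xy(1-3) no_turn] xy(4,5) by blast
    then show False using eq lt by (auto simp: h_def)
  qed
  have "inj_on h X"
  proof (rule inj_onI)
    fix x y assume "x \<in> X" "y \<in> X" "h x = h y"
    then show "x = y" using aux [of x y] aux [of y x] by (cases x y rule: linorder_cases) auto
  qed
  moreover have "h ` X \<subseteq> {..card (turns m)} \<times> turns n"
    using finite_turns by (auto simp: h_def X_def intro!: card_mono)
  ultimately have "finite X" "card X \<le> card ({..card (turns m)} \<times> turns n)"
    using finite_turns inj_on_finite card_inj_on_le by (metis finite_SigmaI finite_atMost)+
  moreover have "card (turns (m + n)) \<le> card (turns m \<union> X)"
    using sub finite_turns \<open>finite X\<close> by (intro card_mono) auto
  moreover have "card (turns m \<union> X) \<le> card (turns m) + card X" by (rule card_Un_le)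
  ultimately show ?thesis by (simp add: card_cartesian_product)
qed

lemma entropy:
  obtains "h_top f \<ge> 0"
    "(\<lambda>n. ln (1 + (\<Sum>j<n. real (card (hits j)))) / real n) \<longlonglongrightarrow> h_top f"
    "\<And>n. exp (h_top f) ^ n \<le> 1 + (\<Sum>j<n. real (card (hits j)))"
proof -
  define N where "N n = 1 + (\<Sum>j<n. real (card (hits j)))" for n
  have N: "N n = real (Suc (card (turns n)))" for n by (simp add: N_def card_turns)
  have sub: "ln (N (m + n)) \<le> ln (N m) + ln (N n)" for m n
  proof -
    have "N (m + n) \<le> N m * N n"
      unfolding N of_nat_mult [symmetric] of_nat_le_iff by (rule card_turns_submult)
    then have "ln (N (m + n)) \<le> ln (N m * N n)" by (simp add: N)
    also have "\<dots> = ln (N m) + ln (N n)" by (rule ln_mult_pos) (simp_all add: N)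
    finally show ?thesis .
  qed
  have nonneg: "0 \<le> ln (N n)" for n by (simp add: N)
  obtain L where L: "(\<lambda>n. ln (N n) / real n) \<longlonglongrightarrow> L" "\<And>n. real n * L \<le> ln (N n)"
    using fekete [of "\<lambda>n. ln (N n)"] sub nonneg by blast
  \<comment> \<open>Convergence is established first, so the \<open>lim\<close> in the entropy is a
    genuine limit.\<close>
  have "h_top f = L"
    unfolding h_top_def card_branches_iter using L(1) by (intro limI) (simp add: N)
  moreover have "L \<ge> 0" using L(1) by (rule LIMSEQ_le_const) (use nonneg in auto)
  moreover have "exp L ^ n \<le> N n" for n
  proof -
    have "exp L ^ n = exp (real n * L)" by (simp add: exp_of_nat_mult)
    also have "\<dots> \<le> exp (ln (N n))" using L(2) by simp
    finally show ?thesis by (simp add: N)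
  qed
  ultimately show thesis using that L(1) unfolding N_def by simp
qed

section \<open>The root of the kneading series and its conjugates\<close>

lemma kneading_root:
  assumes "h_top f \<noteq> 0"
  shows "(\<lambda>j. kneading j * (1 / exp (h_top f)) ^ j) sums 0"
proof -
  obtain "h_top f \<ge> 0"
    "(\<lambda>n. ln (1 + (\<Sum>j<n. real (card (hits j)))) / real n) \<longlonglongrightarrow> h_top f"
    "\<And>n. exp (h_top f) ^ n \<le> 1 + (\<Sum>j<n. real (card (hits j)))"
    by (rule entropy) blast
  moreover have "\<bar>kneading j\<bar> \<le> 1" for j using kneading_sign [of j] by auto
  ultimately show ?thesis
    using assms card_hits_kneading_le
    by (intro convolution_bounded_imp_root [where g = "\<lambda>j. real (card (hits j))"]) auto
qed

text \<open>Over one period of the orbit the slope product may be -1; over two periods it is a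
  square, hence 1. So the period is doubled.\<close>

lemma kneading_eventually_periodic:
  assumes "finite (range (\<lambda>j. (f ^^ j) c))"
  obtains m q where "q > 0" "\<And>j. j > m \<Longrightarrow> kneading (j + q) = kneading j"
proof -
  have "\<not> inj (\<lambda>j. (f ^^ j) c)" using assms finite_imageD by blast
  then obtain a b where ab: "a < b" "(f ^^ a) c = (f ^^ b) c"
    unfolding inj_def by (metis nat_neq_iff)
  define p where "p = b - a"
  have p: "p > 0" "b = a + p" using ab by (auto simp: p_def)
  have per: "(f ^^ (j + p)) c = (f ^^ j) c" if "a \<le> j" for j
  proof -
    have "(f ^^ (j + p)) c = (f ^^ (j - a)) ((f ^^ b) c)"
      using that p funpow_add [of "j - a" b f] by simp
    also have "\<dots> = (f ^^ j) c" using that ab(2) funpow_add [of "j - a" a f] by simp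
    finally show ?thesis .
  qed
  have iter_fc: "(f ^^ i) (f c) = (f ^^ Suc i) c" for i
    by (simp add: funpow_Suc_right del: funpow.simps)
  have "kneading (j + (p + p)) = kneading j" if "a < j" for j
  proof -
    have "(f ^^ (j + p)) (f c) = (f ^^ j) (f c)"
      using per [of "Suc j"] that unfolding iter_fc by simp
    then have "kneading (j + (p + p)) = kneading j * slope_prod p ((f ^^ j) (f c)) * slope_prod p ((f ^^ j) (f c))"
      unfolding kneading_def add.assoc [symmetric] by (simp add: slope_prod_add)
    then show ?thesis using slope_prod_sign [of p "(f ^^ j) (f c)"] by auto
  qed
  then show thesis using that [of "p + p" a] p by blast
qed

lemma galois_conjugate_bound:
  assumes pcf: "finite (range (\<lambda>j. (f ^^ j) c))"
    and conj: "galois_conjugate z (complex_of_real (exp (h_top f)))" and z: "z \<notin> \<real>"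
  shows "cmod z < 2 - 3/100"
proof (cases "cmod z > 1")
  case True
  define x where "x = complex_of_real (exp (h_top f))"
  \<comment> \<open>With zero entropy \<open>x\<close> would be 1, which has no nonreal
    conjugate.\<close>
  have "h_top f \<noteq> 0"
  proof
    assume "h_top f = 0"
    then have "poly (map_poly of_rat [:-1, 1:]) x = 0" by (simp add: x_def map_poly_pCons)
    then have "poly (map_poly of_rat [:-1, 1:]) z = 0"
      using galois_conjugate_root conj x_def by blast
    then have "z = 1" by (simp add: map_poly_pCons)
    then show False using z by simp
  qed
  then have "(\<lambda>j. complex_of_real (kneading j * (1 / exp (h_top f)) ^ j)) sums of_real 0"
    unfolding sums_of_real_iff by (rule kneading_root)
  then have root: "(\<lambda>j. of_real (kneading j) * (1 / x) ^ j) sums 0" by (simp add: x_def)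
  obtain m q where per: "q > 0" "\<And>j. j > m \<Longrightarrow> kneading (j + q) = kneading j"
    by (rule kneading_eventually_periodic [OF pcf]) blast
  have x0: "x \<noteq> 0" by (simp add: x_def)
  have zroot: "(\<lambda>j. of_real (kneading j) * (1 / z) ^ j) sums 0"
    by (rule sign_series_conjugate_root [OF conj [folded x_def] kneading_sign per x0 root True])
  have nr: "1 / z \<notin> \<real>" using z Reals_inverse [of "inverse z"] by (auto simp: divide_inverse)
  have "kneading 0 = 1" by (simp add: kneading_def slope_prod_def)
  then have "\<not> cmod (1 / z) \<le> 51/100"
    using sign_series_nonzero [of kneading, OF _ kneading_sign _ nr] zroot by blast
  \<comment> \<open>This gives \<open>cmod z < 100/51\<close>, which is below 197/100; hence the
    constant 3/100.\<close>
  then have "51/100 < 1 / cmod z" by (simp add: norm_divide)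
  moreover have "0 < cmod z" using True by linarith
  ultimately show ?thesis by (simp add: field_simps)
qed auto

end

lemma turning_map_of_turning_point:
  assumes cont: "continuous_on {0..1} f" and maps: "f ` {0..1} \<subseteq> {0..1}" and c: "turning_point f c"
  obtains e where "turning_map f c e"
proof -
  have mono: "sgn (f y - f x) = sgn (y - x)" if "strict_mono_on A f" "x \<in> A" "y \<in> A" for A and x y :: real
    using strict_mono_onD [OF that(1), of x y] strict_mono_onD [OF that(1), of y x] that(2,3)
    by (cases x y rule: linorder_cases) auto
  have anti: "sgn (f y - f x) = - sgn (y - x)" if "strict_antimono_on A f" "x \<in> A" "y \<in> A" for A and x y :: real
    using monotone_onD [OF that(1), of x y] monotone_onD [OF that(1), of y x] that(2,3)
    by (cases x y rule: linorder_cases) auto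
  from c consider "strict_mono_on {0..c} f" "strict_antimono_on {c..1} f"
    | "strict_antimono_on {0..c} f" "strict_mono_on {c..1} f"
    by (auto simp: turning_point_def)
  then show thesis
  proof cases
    case 1
    have "turning_map f c 1"
      by unfold_locales
         (use cont maps c mono [OF 1(1)] anti [OF 1(2)] in \<open>auto simp: turning_point_def image_subset_iff\<close>)
    then show thesis by (rule that)
  next
    case 2
    have "turning_map f c (-1)"
      by unfold_locales
         (use cont maps c anti [OF 2(1)] mono [OF 2(2)] in \<open>auto simp: turning_point_def image_subset_iff\<close>)
    then show thesis by (rule that)
  qed
qed

theorem theorem6p2:
  "\<exists>\<epsilon>::real. \<epsilon> > 0 \<and>
     (\<forall>(f::real \<Rightarrow> real) (z::complex).
        unimodal f \<and> post_critically_finite f \<and>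
        galois_conjugate z (complex_of_real (exp (h_top f))) \<and> z \<notin> \<real> \<longrightarrow>
        cmod z < 2 - \<epsilon>)"
proof (intro exI [of _ "3/100"] conjI allI impI)
  fix f :: "real \<Rightarrow> real" and z :: complex
  assume asm: "unimodal f \<and> post_critically_finite f \<and>
    galois_conjugate z (complex_of_real (exp (h_top f))) \<and> z \<notin> \<real>"
  then obtain c where "turning_point f c" and pcf: "finite (range (\<lambda>j. (f ^^ j) c))"
    by (auto simp: post_critically_finite_def)
  then obtain e where "turning_map f c e"
    using asm turning_map_of_turning_point unfolding unimodal_def by blast
  then show "cmod z < 2 - 3/100"
    using turning_map.galois_conjugate_bound pcf asm by blast
qed simp

end
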